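(* Let $K:(0,\infty)\to\mathbb{R}$ be $C^1$ and strictly decreasing with $\int_0^1 K(r)\,r\,dr<\infty$, and let $D(\Omega)=\int_\Omega\int_\Omega K(|x-y|)\,dx\,dy$. Let $\Omega=\triangle_{ABC}\subset\mathbb{R}^2$ be a triangle with $AB$ being the longest side and lying on the $x$-axis, and with $C$ lying on the positive $y$-axis. Suppose $|AB|>|BC|\ge|AC|$. Let $O$ be the origin, and for $t>-1$ let $C_t=(1+t)C$ and $\Omega_t=\sqrt{\tfrac{|OC|}{|OC_t|}}\,\triangle_{ABC_t}$ (the image of the triangle $\triangle_{ABC_t}$ under the dilation centred at $O$ with factor $\sqrt{|OC|/|OC_t|}$). Let $t_1>0$ be the unique positive number such that $|BA|=|BC_{t_1}|$. Then $t\mapsto D(\Omega_t)$ is a strictly increasing function on $(-1,t_1)$.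
   Context: $\triangle_{ABC}$ denotes the triangular region with vertices $A,B,C$, and $|PQ|$ the length of the segment $PQ$. The condition $\int_0^1K(r)r\,dr<\infty$ guarantees that $D$ is finite on bounded planar domains. *)

theory Defs
  imports "HOL-Analysis.Analysis"
begin

text \<open>
  The value \<open>K 0\<close> is irrelevant, since the diagonal point \<open>x = y\<close> is a null set for the inner
  integral.
\<close>
definition D_energy :: "(real \<Rightarrow> real) \<Rightarrow> (real^2) set \<Rightarrow> real" where
  "D_energy K \<Omega> = (LINT y:\<Omega>|lborel. (LINT x:\<Omega>|lborel. K (dist x y)))"

definition triangle :: "real^2 \<Rightarrow> real^2 \<Rightarrow> real^2 \<Rightarrow> (real^2) set" where
  "triangle A B C = convex hull {A, B, C}"

definition moved_vertex :: "real^2 \<Rightarrow> real \<Rightarrow> real^2" where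
  "moved_vertex C t = (1 + t) *\<^sub>R C"

definition rescaled_triangle :: "real^2 \<Rightarrow> real^2 \<Rightarrow> real^2 \<Rightarrow> real \<Rightarrow> (real^2) set" where
  "rescaled_triangle A B C t =
     (\<lambda>x. sqrt (dist 0 C / dist 0 (moved_vertex C t)) *\<^sub>R x) ` triangle A B (moved_vertex C t)"

end

theory Submission imports Defs begin

text \<open>
  In affine coordinates on a triangle the energy becomes an integral over pairs of slices parallel to
  one side. Two slices are intervals whose overlap function is symmetric decreasing, and moving the
  opposite vertex parallel to that side only changes the offset of their centres. Hence, as in
  Steiner symmetrisation, the energy strictly increases when the vertex moves towards the
  perpendicular bisector of the side, and for a fixed side and a fixed area it depends only on the
  distance of the vertex from this bisector.

  A step of the family \<open>\<Omega>\<^sub>t\<close> is, up to congruence, a composition of two such slides: the first one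
  moves \<open>A\<close> parallel to \<open>BC\<close> (or \<open>B\<close> parallel to \<open>AC\<close>) until \<open>AB\<close> has its final length, the second
  one moves \<open>C\<close> parallel to \<open>AB\<close>. The first choice works as long as \<open>|OC\<^sub>t|\<close> is at most the rescaled
  \<open>|OB|\<close>, the second one from there on. The first slide is strict because \<open>AB\<close> is the longest side.
\<close>

section \<open>Linear substitutions in the plane\<close>

text \<open>\<open>K\<close> may be negative, so the comparison of nonnegative integrals does not
  apply to it directly. Two triangles that are compared have equal area and lie within a bounded
  range of distances; on that range \<open>K\<close> differs by a constant from a positive kernel,
  and the constant adds the same amount to both energies. The positive kernel may still be so
  singular that a slice paired with itself has infinite energy, hence strictness requires a separate
  proof that the total energy is finite.

  A slide keeps one side, whereas a step of the family changes the length of \<open>AB\<close> while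
  its altitude foot stays at \<open>O\<close>; the intermediate triangle shares one side with each
  end of the step. Its vertex has to be approached from the far side of both bisectors. For the side
  \<open>AB\<close> this decides between the two choices of the sliding vertex. For the side
  \<open>AC\<close> it means \<open>|AB| > |BC|\<close>, which is why the range ends at
  \<open>t_1\<close>.\<close>

lemma Basis_vec2: "(Basis :: (real^2) set) = {axis 1 1, axis 2 1}"
  by (auto simp: Basis_vec_def UNIV_2)

lemma box_vec2: "box l u = {z :: real^2. l$1 < z$1 \<and> z$1 < u$1 \<and> l$2 < z$2 \<and> z$2 < u$2}"
  unfolding box_def Basis_vec2 by (auto simp: inner_axis)

text \<open>Boxes determine \<open>lborel\<close>, so it is the image of the product measure under
  the coordinate map, and Tonelli splits the integral.\<close>

lemma nn_integral_lborel_vec2: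
  fixes f :: "real^2 \<Rightarrow> ennreal"
  assumes [measurable]: "f \<in> borel_measurable borel"
  shows "(\<integral>\<^sup>+z. f z \<partial>lborel) =
    (\<integral>\<^sup>+y. \<integral>\<^sup>+x. f (x *\<^sub>R axis 1 1 + y *\<^sub>R axis 2 1) \<partial>lborel \<partial>lborel)"
proof -
  define \<iota> :: "real \<times> real \<Rightarrow> real^2" where "\<iota> p = fst p *\<^sub>R axis 1 1 + snd p *\<^sub>R axis 2 1" for p
  have [measurable]: "\<iota> \<in> borel_measurable borel"
    unfolding \<iota>_def by (intro borel_measurable_continuous_onI continuous_intros)
  have \<iota>_nth: "\<iota> p $ 1 = fst p" "\<iota> p $ 2 = snd p" for p
    by (simp_all add: \<iota>_def axis_def)
  have distr: "lborel = distr lborel borel \<iota>"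
  proof (rule lborel_eqI)
    fix l u :: "real^2"
    assume lu: "\<And>b. b \<in> Basis \<Longrightarrow> l \<bullet> b \<le> u \<bullet> b"
    have "l $ 1 \<le> u $ 1" "l $ 2 \<le> u $ 2"
      using lu[of "axis 1 1"] lu[of "axis 2 1"] by (auto simp: Basis_vec2 inner_axis)
    have "\<iota> -` box l u = {l$1<..<u$1} \<times> {l$2<..<u$2}"
      unfolding box_vec2 by (auto simp: \<iota>_nth)
    then have "emeasure (distr lborel borel \<iota>) (box l u)
        = emeasure (lborel \<Otimes>\<^sub>M lborel) ({l$1<..<u$1} \<times> {l$2<..<u$2})"
      by (subst emeasure_distr) (simp_all add: lborel_prod)
    also have "\<dots> = ennreal ((u$1 - l$1) * (u$2 - l$2))"
      using \<open>l $ 1 \<le> u $ 1\<close> \<open>l $ 2 \<le> u $ 2\<close>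
      by (subst lborel.emeasure_pair_measure_Times) (auto simp: ennreal_mult)
    also have "(u$1 - l$1) * (u$2 - l$2) = (\<Prod>b\<in>Basis. (u - l) \<bullet> b)"
      unfolding Basis_vec2 by (simp add: inner_axis axis_eq_axis)
    finally show "emeasure (distr lborel borel \<iota>) (box l u) = ennreal (\<Prod>b\<in>Basis. (u - l) \<bullet> b)" .
  qed simp
  have "(\<integral>\<^sup>+z. f z \<partial>lborel) = (\<integral>\<^sup>+p. f (\<iota> p) \<partial>(lborel \<Otimes>\<^sub>M lborel))"
    by (subst distr, subst nn_integral_distr) (simp_all add: lborel_prod)
  also have "\<dots> = (\<integral>\<^sup>+y. \<integral>\<^sup>+x. f (\<iota> (x, y)) \<partial>lborel \<partial>lborel)"
    by (intro lborel_pair.nn_integral_snd[symmetric]) (simp add: lborel_prod)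
  finally show ?thesis by (simp add: \<iota>_def)
qed

lemma nn_integral_scale:
  fixes f :: "real \<Rightarrow> ennreal" and c :: real
  assumes [measurable]: "f \<in> borel_measurable borel" and "c \<noteq> 0"
  shows "ennreal \<bar>c\<bar> * (\<integral>\<^sup>+x. f (t + c * x) \<partial>lborel) = (\<integral>\<^sup>+x. f x \<partial>lborel)"
  using nn_integral_real_affine[OF assms] by simp

lemma nn_integral_lborel_swap:
  fixes f :: "real \<Rightarrow> real \<Rightarrow> ennreal"
  assumes "case_prod f \<in> borel_measurable borel"
  shows "(\<integral>\<^sup>+y. \<integral>\<^sup>+x. f x y \<partial>lborel \<partial>lborel) = (\<integral>\<^sup>+x. \<integral>\<^sup>+y. f x y \<partial>lborel \<partial>lborel)"
proof -
  have "case_prod f \<in> borel_measurable (lborel \<Otimes>\<^sub>M lborel)"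
    using assms by (simp add: lborel_prod)
  then show ?thesis by (rule lborel_pair.Fubini')
qed

lemma nn_integral_linear2:
  fixes f :: "real \<Rightarrow> real \<Rightarrow> ennreal" and \<alpha> \<beta> \<gamma> \<delta> :: real
  assumes f: "case_prod f \<in> borel_measurable borel" and d: "\<alpha> * \<delta> - \<beta> * \<gamma> \<noteq> 0"
  shows "(\<integral>\<^sup>+y. \<integral>\<^sup>+x. f x y \<partial>lborel \<partial>lborel) =
    ennreal \<bar>\<alpha> * \<delta> - \<beta> * \<gamma>\<bar> *
      (\<integral>\<^sup>+v. \<integral>\<^sup>+u. f (\<alpha> * u + \<beta> * v) (\<gamma> * u + \<delta> * v) \<partial>lborel \<partial>lborel)"
proof -
  have comp[measurable (raw)]: "(\<lambda>x. f (g x) (h x)) \<in> borel_measurable M"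
    if "g \<in> borel_measurable M" "h \<in> borel_measurable M" for g h and M :: "'b measure"
    using measurable_compose[OF borel_measurable_Pair[OF that] f] by simp
  show ?thesis
  proof (cases "\<alpha> = 0")
    case False
    have "ennreal \<bar>\<alpha> * \<delta> - \<beta> * \<gamma>\<bar> * (\<integral>\<^sup>+v. \<integral>\<^sup>+u. f (\<alpha> * u + \<beta> * v) (\<gamma> * u + \<delta> * v) \<partial>lborel \<partial>lborel)
      = ennreal \<bar>(\<alpha> * \<delta> - \<beta> * \<gamma>) / \<alpha>\<bar> * (\<integral>\<^sup>+v. ennreal \<bar>\<alpha>\<bar> * (\<integral>\<^sup>+u. f (\<beta> * v + \<alpha> * u) (\<gamma> * u + \<delta> * v) \<partial>lborel) \<partial>lborel)"
      using False
      by (subst nn_integral_cmult)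
         (auto simp: mult.assoc[symmetric] ennreal_mult[symmetric] abs_divide add.commute)
    also have "(\<integral>\<^sup>+v. ennreal \<bar>\<alpha>\<bar> * (\<integral>\<^sup>+u. f (\<beta> * v + \<alpha> * u) (\<gamma> * u + \<delta> * v) \<partial>lborel) \<partial>lborel)
       = (\<integral>\<^sup>+v. ennreal \<bar>\<alpha>\<bar> * (\<integral>\<^sup>+u. (\<lambda>x. f x (\<gamma> * x / \<alpha> + (\<alpha> * \<delta> - \<beta> * \<gamma>) / \<alpha> * v)) (\<beta> * v + \<alpha> * u) \<partial>lborel) \<partial>lborel)"
      using False by (intro nn_integral_cong arg_cong2[where f="(*)"] arg_cong2[where f=f]) (auto simp: field_simps)
    also have "\<dots> = (\<integral>\<^sup>+v. \<integral>\<^sup>+x. f x (\<gamma> * x / \<alpha> + (\<alpha> * \<delta> - \<beta> * \<gamma>) / \<alpha> * v) \<partial>lborel \<partial>lborel)"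
      using False by (intro nn_integral_cong nn_integral_scale) auto
    also have "\<dots> = (\<integral>\<^sup>+x. \<integral>\<^sup>+v. f x (\<gamma> * x / \<alpha> + (\<alpha> * \<delta> - \<beta> * \<gamma>) / \<alpha> * v) \<partial>lborel \<partial>lborel)"
    proof (rule nn_integral_lborel_swap)
      show "(\<lambda>(x, v). f x (\<gamma> * x / \<alpha> + (\<alpha> * \<delta> - \<beta> * \<gamma>) / \<alpha> * v)) \<in> borel_measurable borel"
        unfolding borel_prod[symmetric] case_prod_beta by measurable
    qed
    also have "ennreal \<bar>(\<alpha> * \<delta> - \<beta> * \<gamma>) / \<alpha>\<bar> * \<dots>
       = (\<integral>\<^sup>+x. ennreal \<bar>(\<alpha> * \<delta> - \<beta> * \<gamma>) / \<alpha>\<bar> * (\<integral>\<^sup>+v. f x (\<gamma> * x / \<alpha> + (\<alpha> * \<delta> - \<beta> * \<gamma>) / \<alpha> * v) \<partial>lborel) \<partial>lborel)"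
      by (subst nn_integral_cmult) auto
    also have "\<dots> = (\<integral>\<^sup>+x. \<integral>\<^sup>+y. f x y \<partial>lborel \<partial>lborel)"
      using False d by (intro nn_integral_cong nn_integral_scale) auto
    finally show ?thesis using nn_integral_lborel_swap[OF f] by simp
  next
    case True
    with d have nz: "\<beta> \<noteq> 0" "\<gamma> \<noteq> 0" by auto
    have "ennreal \<bar>\<alpha> * \<delta> - \<beta> * \<gamma>\<bar> * (\<integral>\<^sup>+v. \<integral>\<^sup>+u. f (\<alpha> * u + \<beta> * v) (\<gamma> * u + \<delta> * v) \<partial>lborel \<partial>lborel)
      = ennreal \<bar>\<beta>\<bar> * (\<integral>\<^sup>+v. ennreal \<bar>\<gamma>\<bar> * (\<integral>\<^sup>+u. f (\<beta> * v) (\<delta> * v + \<gamma> * u) \<partial>lborel) \<partial>lborel)"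
      using True by (subst nn_integral_cmult) (auto simp: mult.assoc[symmetric] ennreal_mult[symmetric] abs_mult[symmetric] add.commute)
    also have "\<dots> = ennreal \<bar>\<beta>\<bar> * (\<integral>\<^sup>+v. \<integral>\<^sup>+y. f (0 + \<beta> * v) y \<partial>lborel \<partial>lborel)"
      using nz
      by (intro arg_cong2[where f="(*)"] refl nn_integral_cong)
         (simp add: nn_integral_scale[of "f _" \<gamma>])
    also have "\<dots> = (\<integral>\<^sup>+x. \<integral>\<^sup>+y. f x y \<partial>lborel \<partial>lborel)"
      using nz by (intro nn_integral_scale) auto
    finally show ?thesis using nn_integral_lborel_swap[OF f] by simp
  qed
qed

section \<open>Sliding two symmetric decreasing functions\<close>

text \<open>Reflection in \<open>\<mu>\<close> maps the right half line onto the left one. With both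
  halves on a common domain, two shifted integrals can be compared point by point.\<close>

lemma nn_integral_fold:
  fixes f :: "real \<Rightarrow> ennreal" and \<mu> :: real
  assumes [measurable]: "f \<in> borel_measurable borel"
  shows "(\<integral>\<^sup>+e. f e \<partial>lborel) = (\<integral>\<^sup>+e. indicator {..<\<mu>} e * (f e + f (2 * \<mu> - e)) \<partial>lborel)"
proof -
  have "(\<integral>\<^sup>+e. f e \<partial>lborel) = (\<integral>\<^sup>+e. indicator {..<\<mu>} e * f e + indicator {\<mu><..} e * f e \<partial>lborel)"
    using AE_lborel_singleton[of \<mu>] by (intro nn_integral_cong_AE) (auto elim!: eventually_mono split: split_indicator)
  also have "\<dots> = (\<integral>\<^sup>+e. indicator {..<\<mu>} e * f e \<partial>lborel) + (\<integral>\<^sup>+e. indicator {\<mu><..} e * f e \<partial>lborel)"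
    by (intro nn_integral_add) auto
  also have "(\<integral>\<^sup>+e. indicator {\<mu><..} e * f e \<partial>lborel)
      = (\<integral>\<^sup>+e. indicator {\<mu><..} (2 * \<mu> + (-1) * e) * f (2 * \<mu> + (-1) * e) \<partial>lborel)"
    using nn_integral_real_affine[of "\<lambda>e. indicator {\<mu><..} e * f e" "-1" "2 * \<mu>"] by simp
  also have "\<dots> = (\<integral>\<^sup>+e. indicator {..<\<mu>} e * f (2 * \<mu> - e) \<partial>lborel)"
    by (intro nn_integral_cong) (auto split: split_indicator)
  also have "(\<integral>\<^sup>+e. indicator {..<\<mu>} e * f e \<partial>lborel) + \<dots>
      = (\<integral>\<^sup>+e. indicator {..<\<mu>} e * f e + indicator {..<\<mu>} e * f (2 * \<mu> - e) \<partial>lborel)"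
    by (intro nn_integral_add[symmetric]) auto
  finally show ?thesis by (simp add: distrib_left)
qed

lemma rearrangement2:
  fixes a a' b b' :: real
  shows "a' \<le> a \<Longrightarrow> b' \<le> b \<Longrightarrow> a * b' + a' * b \<le> a * b + a' * b'"
    and "a' < a \<Longrightarrow> b' < b \<Longrightarrow> a * b' + a' * b < a * b + a' * b'"
proof -
  have eq: "a * b + a' * b' - (a * b' + a' * b) = (a - a') * (b - b')" by algebra
  show "a' \<le> a \<Longrightarrow> b' \<le> b \<Longrightarrow> a * b' + a' * b \<le> a * b + a' * b'"
    using eq mult_nonneg_nonneg[of "a - a'" "b - b'"] by linarith
  show "a' < a \<Longrightarrow> b' < b \<Longrightarrow> a * b' + a' * b < a * b + a' * b'"
    using eq mult_pos_pos[of "a - a'" "b - b'"] by linarith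
qed

text \<open>
  Reflecting in the midpoint of the two shifts interchanges them and reduces the claim to a pointwise
  rearrangement of two products.
\<close>

lemma
  fixes w \<phi> :: "real \<Rightarrow> real" and \<alpha> \<beta> :: real
  assumes [measurable]: "w \<in> borel_measurable borel" "\<phi> \<in> borel_measurable borel"
    and w: "\<And>x. 0 \<le> w x" "\<And>x y. \<bar>x\<bar> \<le> \<bar>y\<bar> \<Longrightarrow> w y \<le> w x"
    and \<phi>: "\<And>x. 0 \<le> \<phi> x" "\<And>x y. \<bar>x\<bar> \<le> \<bar>y\<bar> \<Longrightarrow> \<phi> y \<le> \<phi> x"
    and \<alpha>\<beta>: "0 \<le> \<alpha>" "\<alpha> < \<beta>"
  shows nn_integral_shift_le:
      "(\<integral>\<^sup>+e. ennreal (w e * \<phi> (e - \<beta>)) \<partial>lborel) \<le> (\<integral>\<^sup>+e. ennreal (w e * \<phi> (e - \<alpha>)) \<partial>lborel)"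
    and nn_integral_shift_less:
      "(\<integral>\<^sup>+e. ennreal (w e * \<phi> (e - \<beta>)) \<partial>lborel) \<noteq> \<infinity> \<Longrightarrow> l < u \<Longrightarrow> u \<le> 0 \<Longrightarrow>
      (\<And>x y. l < x \<Longrightarrow> x < u \<Longrightarrow> \<bar>x\<bar> < \<bar>y\<bar> \<Longrightarrow> w y < w x) \<Longrightarrow>
      (\<And>x y. \<bar>x\<bar> < \<bar>y\<bar> \<Longrightarrow> \<phi> y < \<phi> x) \<Longrightarrow>
      (\<integral>\<^sup>+e. ennreal (w e * \<phi> (e - \<beta>)) \<partial>lborel) < (\<integral>\<^sup>+e. ennreal (w e * \<phi> (e - \<alpha>)) \<partial>lborel)"
proof -
  define \<mu> where "\<mu> = (\<alpha> + \<beta>) / 2"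
  define F where "F s s' = (\<lambda>e. indicator {..<\<mu>} e * ennreal (w e * \<phi> (e - s) + w (2 * \<mu> - e) * \<phi> (e - s')))" for s s'
  have [measurable]: "F s s' \<in> borel_measurable borel" for s s'
    unfolding F_def by measurable
  have \<phi>_even: "\<phi> x = \<phi> y" if "\<bar>x\<bar> = \<bar>y\<bar>" for x y
    using \<phi>(2)[of x y] \<phi>(2)[of y x] that by force
  have fold: "(\<integral>\<^sup>+e. ennreal (w e * \<phi> (e - s)) \<partial>lborel) = (\<integral>\<^sup>+e. F s s' e \<partial>lborel)"
    if "s + s' = \<alpha> + \<beta>" for s s'
  proof -
    have "\<phi> (2 * \<mu> - e - s) = \<phi> (e - s')" for e
    proof -
      have "2 * \<mu> - e - s = - (e - s')" using that by (simp add: \<mu>_def field_simps)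
      then show ?thesis by (intro \<phi>_even) simp
    qed
    then show ?thesis
      using w(1) \<phi>(1) by (subst nn_integral_fold[of _ \<mu>]) (simp_all add: F_def flip: ennreal_plus)
  qed
  \<comment> \<open>Since \<open>\<mu> > 0\<close>, a point left of \<open>\<mu>\<close> is nearer
    to 0 than its mirror image, and nearer to \<open>\<alpha>\<close> than to
    \<open>\<beta>\<close>; so both factors are ordered in the same direction.\<close>
  have closer: "\<bar>e\<bar> < \<bar>2 * \<mu> - e\<bar>" "\<bar>e - \<alpha>\<bar> < \<bar>e - \<beta>\<bar>" if "e < \<mu>" for e
    using that \<alpha>\<beta> by (auto simp: \<mu>_def abs_if field_simps)
  have le: "F \<beta> \<alpha> e \<le> F \<alpha> \<beta> e" for e
    unfolding F_def using closer[of e] w(2)[of e "2 * \<mu> - e"] \<phi>(2)[of "e - \<alpha>" "e - \<beta>"]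
    by (auto split: split_indicator intro!: ennreal_leI rearrangement2)
  show "(\<integral>\<^sup>+e. ennreal (w e * \<phi> (e - \<beta>)) \<partial>lborel) \<le> (\<integral>\<^sup>+e. ennreal (w e * \<phi> (e - \<alpha>)) \<partial>lborel)"
    using le by (simp add: fold[of \<alpha> \<beta>] fold[of \<beta> \<alpha>] nn_integral_mono)
  assume fin: "(\<integral>\<^sup>+e. ennreal (w e * \<phi> (e - \<beta>)) \<partial>lborel) \<noteq> \<infinity>" and lu: "l < u" "u \<le> 0"
    and strict: "\<And>x y. l < x \<Longrightarrow> x < u \<Longrightarrow> \<bar>x\<bar> < \<bar>y\<bar> \<Longrightarrow> w y < w x"
      "\<And>x y. \<bar>x\<bar> < \<bar>y\<bar> \<Longrightarrow> \<phi> y < \<phi> x"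
  \<comment> \<open>Strictness of \<open>w\<close> is required only on \<open>(l, u)\<close>,
    because an overlap function has a plateau around 0 and vanishes far out. The bound
    \<open>u \<le> 0\<close> places this interval left of \<open>\<mu>\<close>.\<close>
  have less: "F \<beta> \<alpha> e < F \<alpha> \<beta> e" if "l < e" "e < u" for e
  proof -
    have "e < \<mu>" using that lu \<alpha>\<beta> by (simp add: \<mu>_def)
    then have "w (2 * \<mu> - e) < w e" "\<phi> (e - \<beta>) < \<phi> (e - \<alpha>)"
      using closer[of e] strict that by auto
    from rearrangement2(2)[OF this] show ?thesis
      using \<open>e < \<mu>\<close> w(1) \<phi>(1) by (simp add: F_def ennreal_less_iff del: ennreal_plus)
  qed
  have "\<not> (AE e in lborel. F \<alpha> \<beta> e \<le> F \<beta> \<alpha> e)"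
  proof
    assume "AE e in lborel. F \<alpha> \<beta> e \<le> F \<beta> \<alpha> e"
    then have "AE e in lborel. e \<notin> {l<..<u}"
    proof eventually_elim
      case (elim e)
      then show ?case using less[of e] by auto
    qed
    then have "emeasure lborel {l<..<u} = 0"
      by (subst (asm) AE_iff_null_sets[symmetric]) (auto simp: null_sets_def)
    then show False using lu by simp
  qed
  then show "(\<integral>\<^sup>+e. ennreal (w e * \<phi> (e - \<beta>)) \<partial>lborel) < (\<integral>\<^sup>+e. ennreal (w e * \<phi> (e - \<alpha>)) \<partial>lborel)"
    using fin le by (simp add: fold[of \<alpha> \<beta>] fold[of \<beta> \<alpha>]) (intro nn_integral_less, auto)
qed

section \<open>The energy of a triangle in terms of its slices\<close>

text \<open>A stand-in for \<open>K\<close> up to an additive constant. Positivity is what permits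
  nonnegative integrals and strict comparison; \<open>decreasing_kernel_truncation\<close> supplies
  an instance.\<close>

locale decreasing_kernel =
  fixes k :: "real \<Rightarrow> real"
  assumes measurable_kernel[measurable]: "k \<in> borel_measurable borel"
    and kernel_pos: "0 < k r"
    and kernel_less: "0 < r \<Longrightarrow> r < s \<Longrightarrow> k s < k r"
    and kernel_finite: "(\<integral>\<^sup>+r. indicator {0<..<1} r * ennreal (k r * r) \<partial>lborel) < \<infinity>"
begin

text \<open>
  In affine coordinates \<open>(u, v)\<close> the slice at height \<open>v\<close> is \<open>{0..1 - v}\<close>. The overlap is the length of
  the intersection of the slices at heights \<open>v\<close> and \<open>v'\<close> after translating their centres to distance
  \<open>|e|\<close>. Below, \<open>L\<close> and \<open>H\<close> are the squares of the base and of the height, and \<open>m\<close> is the signed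
  distance of the apex from the perpendicular bisector of the base, divided by the base.
\<close>

definition overlap :: "real \<Rightarrow> real \<Rightarrow> real \<Rightarrow> real" where
  "overlap v v' e = max 0 (1 - (v + v') / 2 - max (\<bar>v - v'\<bar> / 2) \<bar>e\<bar>)"

definition slice_energy :: "real \<Rightarrow> real \<Rightarrow> real \<Rightarrow> real \<Rightarrow> real \<Rightarrow> ennreal" where
  "slice_energy L H m v v' = (\<integral>\<^sup>+e. ennreal (overlap v v' e * k (sqrt (L * (e + (v - v') * m)\<^sup>2 + H * (v - v')\<^sup>2))) \<partial>lborel)"

definition shape_energy :: "real \<Rightarrow> real \<Rightarrow> real \<Rightarrow> ennreal" where
  "shape_energy L H m =
    (\<integral>\<^sup>+v. \<integral>\<^sup>+v'. indicator {0..1} v * indicator {0..1} v' * slice_energy L H m v v' \<partial>lborel \<partial>lborel)"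

lemma overlap_nonneg: "0 \<le> overlap v v' e"
  by (simp add: overlap_def)

lemma overlap_mono: "\<bar>x\<bar> \<le> \<bar>y\<bar> \<Longrightarrow> overlap v v' y \<le> overlap v v' x"
  unfolding overlap_def by (intro max.mono diff_left_mono order_refl)

text \<open>The overlap is a trapezoid: constant while the shorter slice stays inside the longer
  one, that is for \<open>|e| \<le> |v - v'| / 2\<close>, and zero once the slices separate. Only
  its flanks decrease strictly.\<close>

lemma overlap_less:
  assumes "\<bar>v - v'\<bar> / 2 \<le> \<bar>x\<bar>" "\<bar>x\<bar> < 1 - (v + v') / 2" "\<bar>x\<bar> < \<bar>y\<bar>"
  shows "overlap v v' y < overlap v v' x"
proof -
  have "max (\<bar>v - v'\<bar> / 2) \<bar>x\<bar> = \<bar>x\<bar>" "max (\<bar>v - v'\<bar> / 2) \<bar>y\<bar> = \<bar>y\<bar>"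
    using assms by simp_all
  then show ?thesis using assms(2,3) by (simp add: overlap_def max_def)
qed

lemma overlap_le:
  assumes "v \<in> {0..1}" "v' \<in> {0..1}"
  shows "overlap v v' e \<le> indicator {-1..1} e"
proof (cases "e \<in> {-1..1}")
  case True
  have "0 \<le> v" "0 \<le> v'" using assms by auto
  moreover obtain M where M: "M = max (\<bar>v - v'\<bar> / 2) \<bar>e\<bar>" "0 \<le> M" by (simp add: max_def)
  ultimately have "1 - (v + v') / 2 - M \<le> 1" by (simp add: field_simps)
  then have "overlap v v' e \<le> 1" unfolding overlap_def M(1) by simp
  then show ?thesis using True by simp
next
  case False
  then have "\<bar>e\<bar> > 1" by auto
  moreover have "0 \<le> v" "0 \<le> v'" using assms by auto
  moreover have "\<bar>e\<bar> \<le> max (\<bar>v - v'\<bar> / 2) \<bar>e\<bar>" by simp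
  ultimately have "1 - (v + v') / 2 - max (\<bar>v - v'\<bar> / 2) \<bar>e\<bar> \<le> 0" by (simp add: field_simps del: max.cobounded2)
  then have "overlap v v' e = 0" unfolding overlap_def by simp
  then show ?thesis by simp
qed

lemma measurable_overlap[measurable (raw)]:
  assumes [measurable]: "f \<in> borel_measurable M" "g \<in> borel_measurable M" "h \<in> borel_measurable M"
  shows "(\<lambda>x. overlap (f x) (g x) (h x)) \<in> borel_measurable M"
  unfolding overlap_def by measurable

lemma kernel_le: "0 < r \<Longrightarrow> r \<le> s \<Longrightarrow> k s \<le> k r"
  using kernel_less[of r s] by (cases "r = s") auto

lemma measurable_slice_energy[measurable]:
  "(\<lambda>p. slice_energy L H m (fst p) (snd p)) \<in> borel_measurable (borel \<Otimes>\<^sub>M borel)"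
  unfolding slice_energy_def by measurable

text \<open>The overlap is even, so reflecting \<open>e\<close> changes the sign of the shift. This
  normalises the shift to a nonnegative one, as \<open>nn_integral_shift_le\<close> demands.\<close>

lemma slice_energy_shift:
  "slice_energy L H m v v' =
    (\<integral>\<^sup>+e. ennreal (overlap v v' e * k (sqrt (L * (e - \<bar>(v - v') * m\<bar>)\<^sup>2 + H * (v - v')\<^sup>2))) \<partial>lborel)"
proof (cases "(v - v') * m \<ge> 0")
  case False
  then show ?thesis by (simp add: slice_energy_def)
next
  case True
  let ?f = "\<lambda>e. ennreal (overlap v v' e * k (sqrt (L * (e + (v - v') * m)\<^sup>2 + H * (v - v')\<^sup>2)))"
  have "slice_energy L H m v v' = (\<integral>\<^sup>+e. ?f (0 + (-1) * e) \<partial>lborel)"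
    unfolding slice_energy_def by (subst nn_integral_real_affine[of ?f "-1" 0]) auto
  also have "\<dots> = (\<integral>\<^sup>+e. ennreal (overlap v v' e * k (sqrt (L * (e - \<bar>(v - v') * m\<bar>)\<^sup>2 + H * (v - v')\<^sup>2))) \<partial>lborel)"
  proof (intro nn_integral_cong arg_cong[where f=ennreal])
    fix e
    have "overlap v v' (0 + (-1) * e) = overlap v v' e"
      by (simp add: overlap_def)
    moreover have "(0 + (-1) * e + (v - v') * m)\<^sup>2 = (e - \<bar>(v - v') * m\<bar>)\<^sup>2"
      using True power2_commute[of e "(v - v') * m"] by simp
    ultimately show "overlap v v' (0 + (-1) * e) * k (sqrt (L * (0 + (-1) * e + (v - v') * m)\<^sup>2 + H * (v - v')\<^sup>2))
      = overlap v v' e * k (sqrt (L * (e - \<bar>(v - v') * m\<bar>)\<^sup>2 + H * (v - v')\<^sup>2))"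
      by (simp only:)
  qed
  finally show ?thesis .
qed

lemma slice_energy_cong:
  assumes "v = v' \<or> \<bar>m\<bar> = \<bar>m'\<bar>"
  shows "slice_energy L H m v v' = slice_energy L H m' v v'"
  using assms by (auto simp: slice_energy_shift abs_mult)

context
  fixes L H :: real
  assumes LH: "0 < L" "0 < H"
begin

text \<open>Distinct slices lie on parallel lines at the positive distance
  \<open>sqrt H * |v - v'|\<close>, which bounds the kernel. For \<open>v = v'\<close> the value may
  be infinite.\<close>

lemma slice_energy_finite:
  assumes v: "v \<in> {0..1}" "v' \<in> {0..1}" and ne: "v \<noteq> v'"
  shows "slice_energy L H m v v' < \<infinity>"
proof -
  have le: "overlap v v' e * k (sqrt (L * (e + (v - v') * m)\<^sup>2 + H * (v - v')\<^sup>2))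
      \<le> indicator {-1..1} e * k (sqrt (H * (v - v')\<^sup>2))" for e
    using LH ne by (intro mult_mono overlap_le kernel_le v) (auto simp: less_imp_le[OF kernel_pos])
  have le': "ennreal (overlap v v' e * k (sqrt (L * (e + (v - v') * m)\<^sup>2 + H * (v - v')\<^sup>2)))
      \<le> indicator {-1..1} e * ennreal (k (sqrt (H * (v - v')\<^sup>2)))" for e
    using ennreal_leI[OF le[of e]] by (auto split: split_indicator)
  have "slice_energy L H m v v' \<le> (\<integral>\<^sup>+e. indicator {-1..1::real} e * ennreal (k (sqrt (H * (v - v')\<^sup>2))) \<partial>lborel)"
    unfolding slice_energy_def by (rule nn_integral_mono) (rule le')
  also have "\<dots> < \<infinity>"
    by (simp add: nn_integral_multc ennreal_mult_less_top)
  finally show ?thesis .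
qed

text \<open>At fixed heights the kernel is a symmetric strictly decreasing function of the shifted
  variable, and a smaller \<open>|m|\<close> means a smaller shift.\<close>

lemma
  assumes v: "v \<in> {0..1}" "v' \<in> {0..1}" and ne: "v \<noteq> v'" and m: "\<bar>m\<bar> < \<bar>m'\<bar>"
  shows slice_energy_le: "slice_energy L H m' v v' \<le> slice_energy L H m v v'"
    and slice_energy_less: "v < 1 \<Longrightarrow> v' < 1 \<Longrightarrow> slice_energy L H m' v v' < slice_energy L H m v v'"
proof -
  define \<phi> where "\<phi> x = k (sqrt (L * x\<^sup>2 + H * (v - v')\<^sup>2))" for x
  have [measurable]: "\<phi> \<in> borel_measurable borel"
    unfolding \<phi>_def by measurable
  have \<phi>_less: "\<phi> y < \<phi> x" if "\<bar>x\<bar> < \<bar>y\<bar>" for x y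
  proof -
    have "x\<^sup>2 < y\<^sup>2" using that abs_le_square_iff[of y x] by linarith
    then show ?thesis
      unfolding \<phi>_def using LH ne by (intro kernel_less) (auto simp: add_nonneg_pos)
  qed
  have \<phi>_le: "\<phi> y \<le> \<phi> x" if "\<bar>x\<bar> \<le> \<bar>y\<bar>" for x y
  proof (cases "\<bar>x\<bar> = \<bar>y\<bar>")
    case True
    then have "x\<^sup>2 = y\<^sup>2" by (simp add: power2_eq_iff abs_eq_iff)
    then show ?thesis by (simp add: \<phi>_def)
  qed (use \<phi>_less[of x y] that in force)
  have shift: "slice_energy L H m v v' = (\<integral>\<^sup>+e. ennreal (overlap v v' e * \<phi> (e - \<bar>(v - v') * m\<bar>)) \<partial>lborel)" for m
    by (simp add: slice_energy_shift \<phi>_def)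
  have lt: "0 \<le> \<bar>(v - v') * m\<bar>" "\<bar>(v - v') * m\<bar> < \<bar>(v - v') * m'\<bar>"
    using m ne by (auto simp: abs_mult)
  have \<phi>_nonneg: "0 \<le> \<phi> x" for x
    using kernel_pos by (simp add: \<phi>_def less_imp_le)
  show "slice_energy L H m' v v' \<le> slice_energy L H m v v'"
    unfolding shift using lt
    by (intro nn_integral_shift_le overlap_nonneg overlap_mono \<phi>_le \<phi>_nonneg) simp_all
  assume v1: "v < 1" "v' < 1"
  show "slice_energy L H m' v v' < slice_energy L H m v v'"
    unfolding shift
  proof (rule nn_integral_shift_less)
    \<comment> \<open>The interval is the left flank of the trapezoid; it is nonempty because
      \<open>v\<close> and \<open>v'\<close> are less than 1, so that both slices have positive
      length.\<close>
    show "- (1 - (v + v') / 2) < - (\<bar>v - v'\<bar> / 2)"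
      using v1 by (cases "v \<le> v'") (simp_all add: field_simps)
    show "overlap v v' y < overlap v v' x"
      if "- (1 - (v + v') / 2) < x" "x < - (\<bar>v - v'\<bar> / 2)" "\<bar>x\<bar> < \<bar>y\<bar>" for x y
    proof (rule overlap_less)
      have "- (\<bar>v - v'\<bar> / 2) \<le> 0" by simp
      with that(2) have "x < 0" by (rule order.strict_trans2)
      then show "\<bar>v - v'\<bar> / 2 \<le> \<bar>x\<bar>" "\<bar>x\<bar> < 1 - (v + v') / 2" using that by simp_all
    qed (fact that)
    show "(\<integral>\<^sup>+e. ennreal (overlap v v' e * \<phi> (e - \<bar>(v - v') * m'\<bar>)) \<partial>lborel) \<noteq> \<infinity>"
      using slice_energy_finite[OF v ne, of m'] by (simp add: shift)
  qed (simp_all add: lt \<phi>_less \<phi>_le overlap_nonneg overlap_mono \<phi>_nonneg)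
qed

lemma shape_energy_pair:
  "shape_energy L H m = (\<integral>\<^sup>+p. indicator ({0..1} \<times> {0..1}) p * slice_energy L H m (fst p) (snd p) \<partial>(lborel \<Otimes>\<^sub>M lborel))"
  unfolding shape_energy_def
proof (subst lborel.nn_integral_fst[symmetric])
  show "(\<lambda>p. indicator ({0..1} \<times> {0..1}) p * slice_energy L H m (fst p) (snd p)) \<in> borel_measurable (lborel \<Otimes>\<^sub>M lborel)"
    by measurable
qed (simp add: indicator_times)

lemma shape_energy_cong: "\<bar>m\<bar> = \<bar>m'\<bar> \<Longrightarrow> shape_energy L H m = shape_energy L H m'"
  unfolding shape_energy_def by (simp add: slice_energy_cong[of _ _ m m'])

text \<open>Slices at different heights compare by \<open>slice_energy_le\<close>. On the diagonal
  the shift vanishes, so equality holds there even if both values are infinite.\<close>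

lemma shape_energy_less:
  assumes m: "\<bar>m\<bar> < \<bar>m'\<bar>" and fin: "shape_energy L H m' \<noteq> \<infinity>"
  shows "shape_energy L H m' < shape_energy L H m"
proof -
  define I :: "(real \<times> real) set" where "I = {0..1} \<times> {0..1}"
  let ?f = "\<lambda>m p. indicator I p * slice_energy L H m (fst p) (snd p)"
  have "(\<integral>\<^sup>+p. ?f m' p \<partial>(lborel \<Otimes>\<^sub>M lborel)) < (\<integral>\<^sup>+p. ?f m p \<partial>(lborel \<Otimes>\<^sub>M lborel))"
  proof (rule nn_integral_less)
    show "AE p in lborel \<Otimes>\<^sub>M lborel. ?f m' p \<le> ?f m p"
    proof (intro AE_I2)
      fix p :: "real \<times> real"
      show "?f m' p \<le> ?f m p"
        using slice_energy_le[OF _ _ _ m, of "fst p" "snd p"] slice_energy_cong[of "fst p" "snd p" m' m L H]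
        by (cases "fst p = snd p") (auto simp: I_def split: split_indicator)
    qed
    show "\<not> (AE p in lborel \<Otimes>\<^sub>M lborel. ?f m p \<le> ?f m' p)"
    proof
      \<comment> \<open>A rectangle of measure 1/4 that misses the diagonal and the degenerate slice
        at height 1, so that every point of it gives a strict comparison.\<close>
      define S :: "(real \<times> real) set" where "S = {0<..<1/2} \<times> {1/2<..<1}"
      assume "AE p in lborel \<Otimes>\<^sub>M lborel. ?f m p \<le> ?f m' p"
      then have "AE p in lborel \<Otimes>\<^sub>M lborel. p \<notin> S"
      proof eventually_elim
        case (elim p)
        show ?case
        proof
          assume "p \<in> S"
          then have "?f m' p < ?f m p"
            using slice_energy_less[OF _ _ _ m, of "fst p" "snd p"] by (auto simp: S_def I_def)
          with elim show False by simp
        qed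
      qed
      then have "emeasure (lborel \<Otimes>\<^sub>M lborel) S = 0"
        by (subst (asm) AE_iff_null_sets[symmetric]) (auto simp: S_def null_sets_def)
      then show False
        by (simp add: S_def lborel.emeasure_pair_measure_Times ennreal_mult[symmetric])
    qed
    show "(\<integral>\<^sup>+p. ?f m' p \<partial>(lborel \<Otimes>\<^sub>M lborel)) \<noteq> \<infinity>"
      using fin unfolding shape_energy_pair I_def .
  qed (unfold I_def, measurable)
  then show ?thesis unfolding shape_energy_pair I_def .
qed

end

end

section \<open>Finiteness of the energy\<close>

context decreasing_kernel
begin

text \<open>After substituting \<open>x / c\<close>, the part below 1 is controlled by
  \<open>kernel_finite\<close>; on the remaining bounded part the kernel is at most
  \<open>k 1\<close>. The majorant \<open>g\<close> adds both bounds.\<close>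

lemma kernel_halfline_finite:
  assumes c: "0 < c" and R: "0 < R"
  shows "(\<integral>\<^sup>+x. indicator {0..R} x * ennreal (x * k (c * x)) \<partial>lborel) < \<infinity>"
proof -
  define f where "f x = indicator {0..R} x * ennreal (x * k (c * x))" for x
  define g where "g x = ennreal (1 / c) * (indicator {0<..<1} x * ennreal (k x * x)) + ennreal (R * k 1) * indicator {0..c * R} x" for x
  have [measurable]: "f \<in> borel_measurable borel"
    unfolding f_def by measurable
  have "f (0 + (1 / c) * x) \<le> g x" for x
  proof (cases "0 < x \<and> x \<le> c * R")
    case False
    then have "(1 / c) * x \<le> 0 \<or> R < (1 / c) * x" using c by (auto simp: field_simps)
    then have "f (0 + (1 / c) * x) = 0" by (auto simp: f_def ennreal_neg split: split_indicator)
    then show ?thesis by simp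
  next
    case True
    then have "f (0 + (1 / c) * x) = ennreal (x / c * k x)"
      using c by (simp add: f_def field_simps)
    also have "\<dots> \<le> g x"
    proof (cases "x < 1")
      case x: True
      have "ennreal (x / c * k x) = ennreal (1 / c) * ennreal (k x * x)"
        using c True kernel_pos[of x] by (subst ennreal_mult[symmetric]) (simp_all add: mult.commute)
      also have "\<dots> \<le> g x" using True x by (simp add: g_def)
      finally show ?thesis .
    next
      case False
      have "x / c * k x \<le> R * k 1"
        using True False c R kernel_pos[of x]
        by (intro mult_mono kernel_le) (simp_all add: field_simps)
      then have "ennreal (x / c * k x) \<le> ennreal (R * k 1)" by (rule ennreal_leI)
      also have "\<dots> \<le> g x" using True False by (simp add: g_def)
      finally show ?thesis .
    qed
    finally show ?thesis .
  qed
  then have "(\<integral>\<^sup>+x. f (0 + (1 / c) * x) \<partial>lborel) \<le> (\<integral>\<^sup>+x. g x \<partial>lborel)"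
    by (simp add: nn_integral_mono)
  also have "\<dots> < \<infinity>"
    unfolding g_def using kernel_finite c R by (simp add: nn_integral_add nn_integral_cmult ennreal_mult_less_top)
  finally have "ennreal \<bar>1 / c\<bar> * (\<integral>\<^sup>+x. f (0 + (1 / c) * x) \<partial>lborel) < \<infinity>"
    by (simp add: ennreal_mult_less_top)
  then show ?thesis
    using nn_integral_scale[of f "1 / c" 0] c by (simp add: f_def)
qed

lemma kernel_radial_finite:
  assumes c: "0 < c" and R: "0 < R"
  shows "(\<integral>\<^sup>+x. indicator {-R..R} x * ennreal (\<bar>x\<bar> * k (c * \<bar>x\<bar>)) \<partial>lborel) < \<infinity>"
proof -
  let ?h = "\<lambda>x. indicator {0..R} x * ennreal (x * k (c * x))"
  have "(\<integral>\<^sup>+x. indicator {-R..R} x * ennreal (\<bar>x\<bar> * k (c * \<bar>x\<bar>)) \<partial>lborel)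
      \<le> (\<integral>\<^sup>+x. ?h x + ?h (0 + (-1) * x) \<partial>lborel)"
    by (intro nn_integral_mono) (auto split: split_indicator simp: abs_if)
  also have "\<dots> = (\<integral>\<^sup>+x. ?h x \<partial>lborel) + (\<integral>\<^sup>+x. ?h (0 + (-1) * x) \<partial>lborel)"
    by (intro nn_integral_add) auto
  also have "(\<integral>\<^sup>+x. ?h (0 + (-1) * x) \<partial>lborel) = (\<integral>\<^sup>+x. ?h x \<partial>lborel)"
    by (subst nn_integral_real_affine[of ?h "-1" 0]) auto
  also have "(\<integral>\<^sup>+x. ?h x \<partial>lborel) + (\<integral>\<^sup>+x. ?h x \<partial>lborel) < \<infinity>"
    using kernel_halfline_finite[OF assms] by simp
  finally show ?thesis .
qed

text \<open>The distance is at least \<open>c\<close> times the maximum of \<open>|e|\<close> and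
  \<open>|v - v'|\<close>, once the offset is absorbed into \<open>e\<close>. Integrating out the
  smaller of these two variables gives a length twice the larger one, which is the weight
  \<open>r\<close> that makes the kernel integrable. The maximum norm thus replaces polar
  coordinates.\<close>

lemma shape_energy_finite:
  assumes LH: "0 < L" "0 < H"
  shows "shape_energy L H m < \<infinity>"
proof -
  define c where "c = min (sqrt L) (sqrt H)"
  have c: "0 < c" using LH by (simp add: c_def)
  have c2: "c\<^sup>2 \<le> L" "c\<^sup>2 \<le> H"
    using LH power_mono[of c "sqrt L" 2] power_mono[of c "sqrt H" 2] by (auto simp: c_def)
  \<comment> \<open>Since \<open>|v - v'| \<le> 1\<close>, the offset is at most \<open>|m|\<close>
    and moves the support \<open>[-1, 1]\<close> of the overlap into \<open>[-R, R]\<close>.\<close>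
  define R where "R = 1 + \<bar>m\<bar>"
  have R: "0 < R" by (simp add: R_def)
  \<comment> \<open>One summand for each choice of the larger variable: the kernel sees only that
    variable, and the other one ranges over a symmetric interval bounded by it.\<close>
  define b where "b \<eta> e = indicator {-1..1} \<eta> * (indicator {-R..R} e *
      (indicator {-\<bar>e\<bar>..\<bar>e\<bar>} \<eta> * ennreal (k (c * \<bar>e\<bar>)) + indicator {-\<bar>\<eta>\<bar>..\<bar>\<eta>\<bar>} e * ennreal (k (c * \<bar>\<eta>\<bar>))))" for \<eta> e :: real
  define b1 where "b1 \<eta> e = (indicator {-R..R} e * ennreal (k (c * \<bar>e\<bar>))) * indicator {-\<bar>e\<bar>..\<bar>e\<bar>} \<eta>" for \<eta> e :: real
  define b2 where "b2 \<eta> e = (indicator {-1..1} \<eta> * ennreal (k (c * \<bar>\<eta>\<bar>))) * indicator {-\<bar>\<eta>\<bar>..\<bar>\<eta>\<bar>} e" for \<eta> e :: real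
  have [measurable (raw)]: "(\<lambda>p. indicator {-\<bar>f p\<bar>..\<bar>f p\<bar>} (g p) :: ennreal) \<in> borel_measurable M"
    if [measurable]: "f \<in> borel_measurable M" "g \<in> borel_measurable M" for f g :: "'z \<Rightarrow> real" and M
  proof -
    have "(\<lambda>p. if - \<bar>f p\<bar> \<le> g p \<and> g p \<le> \<bar>f p\<bar> then 1 else 0 :: ennreal) \<in> borel_measurable M"
      by measurable
    then show ?thesis by (simp add: indicator_def of_bool_def)
  qed
  have [measurable (raw)]: "(\<lambda>x. b (f x) (g x)) \<in> borel_measurable M" "(\<lambda>x. b1 (f x) (g x)) \<in> borel_measurable M"
    "(\<lambda>x. b2 (f x) (g x)) \<in> borel_measurable M"
    if [measurable]: "f \<in> borel_measurable M" "g \<in> borel_measurable M" for f g and M :: "'z measure"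
    unfolding b_def b1_def b2_def by measurable
  have slice: "slice_energy L H m v v' \<le> (\<integral>\<^sup>+e. b (v - v') e \<partial>lborel)"
    if v: "v \<in> {0..1}" "v' \<in> {0..1}" and ne: "v \<noteq> v'" for v v'
  proof -
    define \<eta> where "\<eta> = v - v'"
    have \<eta>: "\<eta> \<noteq> 0" "\<bar>\<eta>\<bar> \<le> 1" using v ne by (auto simp: \<eta>_def)
    have "slice_energy L H m v v' = (\<integral>\<^sup>+e. ennreal (overlap v v' (- (\<eta> * m) + 1 * e) * k (sqrt (L * ((- (\<eta> * m) + 1 * e) + \<eta> * m)\<^sup>2 + H * \<eta>\<^sup>2))) \<partial>lborel)"
      unfolding slice_energy_def \<eta>_def
      by (subst nn_integral_real_affine[where c=1 and t="- ((v - v') * m)"]) auto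
    also have "\<dots> \<le> (\<integral>\<^sup>+e. b \<eta> e \<partial>lborel)"
    proof (rule nn_integral_mono)
      fix e :: real
      have ov: "overlap v v' (- (\<eta> * m) + 1 * e) \<le> indicator {-R..R} e"
      proof -
        have "\<bar>\<eta> * m\<bar> \<le> \<bar>m\<bar>" using \<eta>(2) by (simp add: abs_mult mult_left_le_one_le)
        then have "e \<in> {-R..R}" if "- (\<eta> * m) + 1 * e \<in> {-1..1}"
          using that by (auto simp: R_def)
        then show ?thesis
          using overlap_le[OF v, of "- (\<eta> * m) + 1 * e"] by (auto split: split_indicator_asm split_indicator)
      qed
      define s where "s = max \<bar>e\<bar> \<bar>\<eta>\<bar>"
      have s: "0 < s" using \<eta> by (simp add: s_def less_max_iff_disj)
      have "(c * s)\<^sup>2 \<le> L * e\<^sup>2 + H * \<eta>\<^sup>2"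
      proof (cases "\<bar>e\<bar> \<le> \<bar>\<eta>\<bar>")
        case True
        then have "(c * s)\<^sup>2 = c\<^sup>2 * \<eta>\<^sup>2" by (simp add: s_def power_mult_distrib)
        also have "\<dots> \<le> H * \<eta>\<^sup>2" using c2 by (intro mult_right_mono) auto
        finally show ?thesis using LH by (simp add: add_increasing)
      next
        case False
        then have "(c * s)\<^sup>2 = c\<^sup>2 * e\<^sup>2" by (simp add: s_def power_mult_distrib)
        also have "\<dots> \<le> L * e\<^sup>2" using c2 by (intro mult_right_mono) auto
        finally show ?thesis using LH by (simp add: add_increasing2)
      qed
      then have "c * s \<le> sqrt (L * e\<^sup>2 + H * \<eta>\<^sup>2)" by (rule real_le_rsqrt)
      then have "k (sqrt (L * e\<^sup>2 + H * \<eta>\<^sup>2)) \<le> k (c * s)" using c s by (intro kernel_le) auto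
      with ov have "overlap v v' (- (\<eta> * m) + 1 * e) * k (sqrt (L * ((- (\<eta> * m) + 1 * e) + \<eta> * m)\<^sup>2 + H * \<eta>\<^sup>2)) \<le> indicator {-R..R} e * k (c * s)"
        using kernel_pos by (intro mult_mono) (auto simp: less_imp_le)
      then have "ennreal (overlap v v' (- (\<eta> * m) + 1 * e) * k (sqrt (L * ((- (\<eta> * m) + 1 * e) + \<eta> * m)\<^sup>2 + H * \<eta>\<^sup>2)))
         \<le> ennreal (indicator {-R..R} e * k (c * s))" by (rule ennreal_leI)
      also have "\<dots> = indicator {-R..R} e * ennreal (k (c * s))" by (simp split: split_indicator)
      also have "\<dots> \<le> b \<eta> e"
      proof (cases "\<bar>e\<bar> \<le> \<bar>\<eta>\<bar>")
        case True
        then have "e \<in> {-\<bar>\<eta>\<bar>..\<bar>\<eta>\<bar>}" "s = \<bar>\<eta>\<bar>" "\<eta> \<in> {-1..1}" using \<eta> by (auto simp: s_def)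
        then show ?thesis unfolding b_def by (simp split: split_indicator)
      next
        case False
        then have "\<eta> \<in> {-\<bar>e\<bar>..\<bar>e\<bar>}" "s = \<bar>e\<bar>" "\<eta> \<in> {-1..1}" using \<eta> by (auto simp: s_def)
        then show ?thesis unfolding b_def by (simp split: split_indicator)
      qed
      finally show "ennreal (overlap v v' (- (\<eta> * m) + 1 * e) * k (sqrt (L * ((- (\<eta> * m) + 1 * e) + \<eta> * m)\<^sup>2 + H * \<eta>\<^sup>2))) \<le> b \<eta> e" .
    qed
    finally show ?thesis by (simp add: \<eta>_def)
  qed
  define C where "C = (\<integral>\<^sup>+\<eta>. \<integral>\<^sup>+e. b \<eta> e \<partial>lborel \<partial>lborel)"
  have "C \<le> (\<integral>\<^sup>+\<eta>. \<integral>\<^sup>+e. b1 \<eta> e + b2 \<eta> e \<partial>lborel \<partial>lborel)"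
    unfolding C_def by (intro nn_integral_mono) (auto simp: b_def b1_def b2_def split: split_indicator)
  also have "\<dots> = (\<integral>\<^sup>+\<eta>. \<integral>\<^sup>+e. b1 \<eta> e \<partial>lborel \<partial>lborel) + (\<integral>\<^sup>+\<eta>. \<integral>\<^sup>+e. b2 \<eta> e \<partial>lborel \<partial>lborel)"
    by (simp add: nn_integral_add)
  also have "(\<integral>\<^sup>+\<eta>. \<integral>\<^sup>+e. b1 \<eta> e \<partial>lborel \<partial>lborel) = (\<integral>\<^sup>+e. \<integral>\<^sup>+\<eta>. b1 \<eta> e \<partial>lborel \<partial>lborel)"
    by (rule lborel_pair.Fubini') (simp add: case_prod_beta)
  also have "\<dots> = (\<integral>\<^sup>+e. 2 * (indicator {-R..R} e * ennreal (\<bar>e\<bar> * k (c * \<bar>e\<bar>))) \<partial>lborel)"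
    unfolding b1_def using kernel_pos
    by (intro nn_integral_cong) (simp add: nn_integral_cmult ennreal_mult' mult_ac less_imp_le)
  also have "(\<integral>\<^sup>+\<eta>. \<integral>\<^sup>+e. b2 \<eta> e \<partial>lborel \<partial>lborel) = (\<integral>\<^sup>+e. 2 * (indicator {-1..1} e * ennreal (\<bar>e\<bar> * k (c * \<bar>e\<bar>))) \<partial>lborel)"
    unfolding b2_def using kernel_pos
    by (intro nn_integral_cong) (simp add: nn_integral_cmult ennreal_mult' mult_ac less_imp_le)
  also have "(\<integral>\<^sup>+e. 2 * (indicator {-R..R} e * ennreal (\<bar>e\<bar> * k (c * \<bar>e\<bar>))) \<partial>lborel)
      + (\<integral>\<^sup>+e. 2 * (indicator {-1..1} e * ennreal (\<bar>e\<bar> * k (c * \<bar>e\<bar>))) \<partial>lborel) < \<infinity>"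
    using kernel_radial_finite[OF c R] kernel_radial_finite[OF c, of 1]
    by (simp add: nn_integral_cmult ennreal_mult_less_top)
  finally have C: "C < \<infinity>" .
  have "shape_energy L H m \<le> (\<integral>\<^sup>+v. indicator {0..1::real} v * C \<partial>lborel)"
    unfolding shape_energy_def
  proof (rule nn_integral_mono)
    fix v :: real
    \<comment> \<open>The slice bound leaves out the single point \<open>v' = v\<close>. Dropping
      the indicator of \<open>v'\<close> makes the inner integral independent of
      \<open>v\<close>.\<close>
    have "(\<integral>\<^sup>+v'. indicator {0..1} v * indicator {0..1} v' * slice_energy L H m v v' \<partial>lborel)
        \<le> (\<integral>\<^sup>+v'. indicator {0..1} v * (\<integral>\<^sup>+e. b (v + (-1) * v') e \<partial>lborel) \<partial>lborel)"
      using AE_lborel_singleton[of v] slice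
      by (intro nn_integral_mono_AE) (auto elim!: eventually_mono split: split_indicator)
    also have "\<dots> = indicator {0..1} v * (\<integral>\<^sup>+v'. (\<integral>\<^sup>+e. b (v + (-1) * v') e \<partial>lborel) \<partial>lborel)"
      by (rule nn_integral_cmult) measurable
    also have "(\<integral>\<^sup>+v'. (\<integral>\<^sup>+e. b (v + (-1) * v') e \<partial>lborel) \<partial>lborel) = C"
      unfolding C_def by (subst nn_integral_real_affine[of _ "-1" v]) auto
    finally show "(\<integral>\<^sup>+v'. indicator {0..1} v * indicator {0..1} v' * slice_energy L H m v v' \<partial>lborel) \<le> indicator {0..1} v * C" .
  qed
  also have "\<dots> < \<infinity>" using C by (simp add: nn_integral_multc)
  finally show ?thesis .
qed

end

section \<open>Affine coordinates on a triangle\<close>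

definition cross2 :: "real^2 \<Rightarrow> real^2 \<Rightarrow> real" where
  "cross2 p q = p $ 1 * q $ 2 - p $ 2 * q $ 1"

lemma nn_integral_affine_vec2:
  fixes f :: "real^2 \<Rightarrow> ennreal" and P p q :: "real^2"
  assumes [measurable]: "f \<in> borel_measurable borel" and d: "cross2 p q \<noteq> 0"
  shows "(\<integral>\<^sup>+z. f z \<partial>lborel) =
    ennreal \<bar>cross2 p q\<bar> * (\<integral>\<^sup>+v. \<integral>\<^sup>+u. f (P + u *\<^sub>R p + v *\<^sub>R q) \<partial>lborel \<partial>lborel)"
proof -
  have "(\<integral>\<^sup>+z. f z \<partial>lborel) = (\<integral>\<^sup>+z. f (P + z) \<partial>lborel)"
    by (subst lborel_distr_plus[of P, symmetric], subst nn_integral_distr) auto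
  also have "\<dots> = (\<integral>\<^sup>+y. \<integral>\<^sup>+x. f (P + (x *\<^sub>R axis 1 1 + y *\<^sub>R axis 2 1)) \<partial>lborel \<partial>lborel)"
    by (intro nn_integral_lborel_vec2) measurable
  also have "\<dots> = ennreal \<bar>p $ 1 * q $ 2 - q $ 1 * p $ 2\<bar> * (\<integral>\<^sup>+v. \<integral>\<^sup>+u.
      f (P + ((p $ 1 * u + q $ 1 * v) *\<^sub>R axis 1 1 + (p $ 2 * u + q $ 2 * v) *\<^sub>R axis 2 1)) \<partial>lborel \<partial>lborel)"
  proof (rule nn_integral_linear2)
    show "(\<lambda>(x, y). f (P + (x *\<^sub>R axis 1 1 + y *\<^sub>R axis 2 1))) \<in> borel_measurable borel"
      unfolding borel_prod[symmetric] case_prod_beta by measurable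
    show "p $ 1 * q $ 2 - q $ 1 * p $ 2 \<noteq> 0" using d by (simp add: cross2_def mult.commute)
  qed
  finally have "(\<integral>\<^sup>+z. f z \<partial>lborel) = \<dots>" .
  moreover have "(p $ 1 * u + q $ 1 * v) *\<^sub>R axis 1 1 + (p $ 2 * u + q $ 2 * v) *\<^sub>R axis 2 1 = u *\<^sub>R p + v *\<^sub>R q" for u v
    by (simp add: vec_eq_iff forall_2 axis_def algebra_simps)
  ultimately show ?thesis by (simp add: cross2_def mult.commute add.assoc)
qed

text \<open>A point of the hull has some admissible coordinates; as the edge vectors are
  independent, Cramer's rule identifies them with the given ones.\<close>

lemma triangle_coordinates:
  assumes d: "cross2 (Q - P) (R - P) \<noteq> 0"
  shows "P + u *\<^sub>R (Q - P) + v *\<^sub>R (R - P) \<in> triangle P Q R \<longleftrightarrow> 0 \<le> u \<and> 0 \<le> v \<and> u + v \<le> 1"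
proof
  assume "P + u *\<^sub>R (Q - P) + v *\<^sub>R (R - P) \<in> triangle P Q R"
  then obtain u' v' where *: "P + u *\<^sub>R (Q - P) + v *\<^sub>R (R - P) = P + u' *\<^sub>R (Q - P) + v' *\<^sub>R (R - P)"
    and **: "0 \<le> u'" "0 \<le> v'" "u' + v' \<le> 1"
    unfolding triangle_def convex_hull_3_alt by auto
  define p q where "p = Q - P" and "q = R - P"
  from * have e: "u * p $ 1 + v * q $ 1 = u' * p $ 1 + v' * q $ 1" "u * p $ 2 + v * q $ 2 = u' * p $ 2 + v' * q $ 2"
    by (simp_all add: vec_eq_iff forall_2 p_def q_def)
  have "(u - u') * cross2 p q = 0" "(v - v') * cross2 p q = 0"
    unfolding cross2_def using e by algebra+
  with d ** show "0 \<le> u \<and> 0 \<le> v \<and> u + v \<le> 1" by (simp add: p_def q_def)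
qed (auto simp: triangle_def convex_hull_3_alt)

lemma compact_triangle: "compact (triangle P Q R)"
  unfolding triangle_def by (intro finite_imp_compact_convex_hull) simp

lemma sets_triangle[measurable]: "triangle P Q R \<in> sets borel"
  using compact_triangle by (intro borel_compact)

text \<open>In affine coordinates each area is the determinant times the same integral over the
  parameter triangle, which need not be evaluated.\<close>

lemma measure_triangle_eq:
  assumes d: "cross2 (Q - P) (R - P) \<noteq> 0" "\<bar>cross2 (Q - P) (R - P)\<bar> = \<bar>cross2 (Q' - P') (R' - P')\<bar>"
  shows "measure lborel (triangle P Q R) = measure lborel (triangle P' Q' R')"
proof -
  have *: "emeasure lborel (triangle P Q R) = ennreal \<bar>cross2 (Q - P) (R - P)\<bar> *
      (\<integral>\<^sup>+v. \<integral>\<^sup>+u. of_bool (0 \<le> u \<and> 0 \<le> v \<and> u + v \<le> 1) \<partial>(lborel :: real measure) \<partial>(lborel :: real measure))"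
    if "cross2 (Q - P) (R - P) \<noteq> 0" for P Q R
  proof -
    have "emeasure lborel (triangle P Q R) = (\<integral>\<^sup>+z. indicator (triangle P Q R) z \<partial>lborel)"
      by simp
    also have "\<dots> = ennreal \<bar>cross2 (Q - P) (R - P)\<bar> *
      (\<integral>\<^sup>+v. \<integral>\<^sup>+u. indicator (triangle P Q R) (P + u *\<^sub>R (Q - P) + v *\<^sub>R (R - P)) \<partial>lborel \<partial>lborel)"
      using that by (intro nn_integral_affine_vec2) measurable
    finally show ?thesis
      using triangle_coordinates[OF that] by (simp add: indicator_def)
  qed
  have "cross2 (Q' - P') (R' - P') \<noteq> 0" using d by auto
  then show ?thesis using d *[of Q P R] *[of Q' P' R'] by (simp add: measure_def)
qed

text \<open>Two intervals meet in the smaller of two lengths (cut off at 0): that of the shorter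
  interval, and the sum of the half lengths minus the distance of the centres. Here the half lengths
  add up to \<open>1 - (v + v') / 2\<close>, and the centres are \<open>|d + (v - v') / 2|\<close>
  apart.\<close>

lemma overlap_integral:
  fixes v v' d :: real
  shows "(\<integral>\<^sup>+u'. indicator {0..1 - v} (u' + d) * indicator {0..1 - v'} u' \<partial>lborel)
    = ennreal (max 0 (1 - (v + v') / 2 - max (\<bar>v - v'\<bar> / 2) \<bar>d + (v - v') / 2\<bar>))"
proof -
  have "(\<integral>\<^sup>+u'. indicator {0..1 - v} (u' + d) * indicator {0..1 - v'} u' \<partial>lborel)
      = (\<integral>\<^sup>+u'. indicator {max 0 (- d)..min (1 - v') (1 - v - d)} u' \<partial>lborel)"
    by (intro nn_integral_cong) (auto split: split_indicator)
  also have "\<dots> = ennreal (max 0 (min (1 - v') (1 - v - d) - max 0 (- d)))"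
    by (simp add: emeasure_lborel_Icc_eq) (simp add: max_def)
  also have "min (1 - v') (1 - v - d) - max 0 (- d) = 1 - (v + v') / 2 - max (\<bar>v - v'\<bar> / 2) \<bar>d + (v - v') / 2\<bar>"
    by (cases "v \<le> v'"; cases "0 \<le> d + (v - v') / 2"; cases "0 \<le> d"; cases "v - v' \<le> - d")
       (simp_all add: min_def max_def field_simps)
  finally show ?thesis .
qed

context decreasing_kernel
begin

definition kernel_energy :: "(real^2) set \<Rightarrow> ennreal" where
  "kernel_energy \<Omega> = (\<integral>\<^sup>+y. indicator \<Omega> y * (\<integral>\<^sup>+x. indicator \<Omega> x * ennreal (k (dist x y)) \<partial>lborel) \<partial>lborel)"

text \<open>The term \<open>1 / 2\<close> next to \<open>m\<close> comes from passing from the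
  difference \<open>d\<close> of left-based coordinates to the difference
  \<open>e = d + (v - v') / 2\<close> of centred ones. The kernel depends on \<open>d\<close> alone,
  so integrating out \<open>u'\<close> leaves the overlap.\<close>

lemma slice_energy_rows:
  "(\<integral>\<^sup>+u'. \<integral>\<^sup>+u. indicator {0..1 - v} u * indicator {0..1 - v'} u' *
      ennreal (k (sqrt (L * (u - u' + (v - v') * (m + 1 / 2))\<^sup>2 + H * (v - v')\<^sup>2))) \<partial>lborel \<partial>lborel)
    = slice_energy L H m v v'"
proof -
  define g where "g d = ennreal (k (sqrt (L * (d + (v - v') * (m + 1 / 2))\<^sup>2 + H * (v - v')\<^sup>2)))" for d
  have [measurable]: "g \<in> borel_measurable borel"
    unfolding g_def by measurable
  have "(\<integral>\<^sup>+u'. \<integral>\<^sup>+u. indicator {0..1 - v} u * indicator {0..1 - v'} u' * g (u - u') \<partial>lborel \<partial>lborel)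
      = (\<integral>\<^sup>+u'. \<integral>\<^sup>+d. indicator {0..1 - v} (u' + d) * indicator {0..1 - v'} u' * g d \<partial>lborel \<partial>lborel)"
  proof (rule nn_integral_cong)
    fix u' :: real
    show "(\<integral>\<^sup>+u. indicator {0..1 - v} u * indicator {0..1 - v'} u' * g (u - u') \<partial>lborel)
      = (\<integral>\<^sup>+d. indicator {0..1 - v} (u' + d) * indicator {0..1 - v'} u' * g d \<partial>lborel)"
      by (subst nn_integral_scale[of _ 1 u', symmetric]) simp_all
  qed
  also have "\<dots> = (\<integral>\<^sup>+d. \<integral>\<^sup>+u'. indicator {0..1 - v} (u' + d) * indicator {0..1 - v'} u' * g d \<partial>lborel \<partial>lborel)"
    by (rule lborel_pair.Fubini') measurable
  also have "\<dots> = (\<integral>\<^sup>+d. ennreal (overlap v v' (d + (v - v') / 2)) * g d \<partial>lborel)"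
    by (intro nn_integral_cong) (simp add: nn_integral_multc overlap_integral overlap_def)
  also have "\<dots> = (\<integral>\<^sup>+e. ennreal (overlap v v' e) * g (- ((v - v') / 2) + 1 * e) \<partial>lborel)"
    by (subst nn_integral_scale[of _ 1 "- ((v - v') / 2)", symmetric]) simp_all
  also have "\<dots> = slice_energy L H m v v'"
    unfolding slice_energy_def g_def
    using kernel_pos by (intro nn_integral_cong) (simp add: ennreal_mult' less_imp_le overlap_nonneg algebra_simps)
  finally show ?thesis by (simp add: g_def)
qed

text \<open>Completing the square in the first coordinate of \<open>s p + t q\<close>, where
  \<open>p\<close> and \<open>q\<close> are the edge vectors from \<open>P\<close>, gives the
  quadratic form of \<open>slice_energy\<close>. The coefficient \<open>(p \<bullet> q) / L\<close>
  is the position of the altitude foot along \<open>PQ\<close>; subtracting \<open>1 / 2\<close>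
  measures it from the midpoint. Each of the two integrations contributes a factor
  \<open>|d|\<close>.\<close>

lemma kernel_energy_triangle:
  fixes P Q R :: "real^2"
  defines "L \<equiv> (dist P Q)\<^sup>2" and "d \<equiv> cross2 (Q - P) (R - P)"
  defines "m \<equiv> ((Q - P) \<bullet> (R - P)) / L - 1 / 2"
  assumes d0: "d \<noteq> 0"
  shows "kernel_energy (triangle P Q R) = (ennreal \<bar>d\<bar>)\<^sup>2 * shape_energy L (d\<^sup>2 / L) m"
proof -
  have "P \<noteq> Q" using d0 by (auto simp: d_def cross2_def)
  then have L: "0 < L" by (simp add: L_def)
  define H where "H = d\<^sup>2 / L"
  define T where "T u v = (indicator {0..1} v * indicator {0..1 - v} u :: ennreal)" for u v :: real
  have [measurable (raw)]: "(\<lambda>x. T (f x) (g x)) \<in> borel_measurable M"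
    if [measurable]: "f \<in> borel_measurable M" "g \<in> borel_measurable M" for f g and M :: "'z measure"
  proof -
    have "(\<lambda>x. if 0 \<le> g x \<and> g x \<le> 1 \<and> 0 \<le> f x \<and> f x \<le> 1 - g x then 1 else 0 :: ennreal) \<in> borel_measurable M"
      by measurable
    moreover have "(\<lambda>x. if 0 \<le> g x \<and> g x \<le> 1 \<and> 0 \<le> f x \<and> f x \<le> 1 - g x then 1 else 0 :: ennreal) = (\<lambda>x. T (f x) (g x))"
      by (auto simp: T_def fun_eq_iff split: split_indicator)
    ultimately show ?thesis by simp
  qed
  define \<phi> where "\<phi> u v = P + u *\<^sub>R (Q - P) + v *\<^sub>R (R - P)" for u v
  define g where "g u v = ennreal (k (sqrt (L * (u + v * (m + 1 / 2))\<^sup>2 + H * v\<^sup>2)))" for u v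
  have [measurable (raw)]: "(\<lambda>x. g (f x) (h x)) \<in> borel_measurable M"
    if [measurable]: "f \<in> borel_measurable M" "h \<in> borel_measurable M" for f h and M :: "'z measure"
    unfolding g_def by measurable
  have T: "indicator (triangle P Q R) (\<phi> u v) = T u v" for u v
    using triangle_coordinates[OF d0[unfolded d_def], of u v]
    by (auto simp: T_def \<phi>_def split: split_indicator)
  have g: "ennreal (k (dist (\<phi> u v) (\<phi> u' v'))) = g (u - u') (v - v')" for u v u' v'
  proof -
    define p q where "p = Q - P" and "q = R - P"
    have L': "L = p \<bullet> p" by (simp add: L_def p_def dist_norm power2_norm_eq_inner norm_minus_commute[of P])
    have m': "(m + 1 / 2) * L = p \<bullet> q" using L by (simp add: m_def p_def q_def)
    \<comment> \<open>Lagrange's identity; it turns the remainder of the completed square into the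
      squared height \<open>H\<close>.\<close>
    have d': "d\<^sup>2 = (p \<bullet> p) * (q \<bullet> q) - (p \<bullet> q)\<^sup>2"
      by (simp add: d_def cross2_def inner_vec_def sum_2 p_def[symmetric] q_def[symmetric]) algebra
    define s t where "s = u - u'" and "t = v - v'"
    have "\<phi> u v - \<phi> u' v' = s *\<^sub>R p + t *\<^sub>R q"
      by (simp add: \<phi>_def p_def q_def s_def t_def algebra_simps)
    then have "(dist (\<phi> u v) (\<phi> u' v'))\<^sup>2 = (s *\<^sub>R p + t *\<^sub>R q) \<bullet> (s *\<^sub>R p + t *\<^sub>R q)"
      by (simp only: dist_norm power2_norm_eq_inner)
    also have "\<dots> = s\<^sup>2 * (p \<bullet> p) + 2 * (s * t) * (p \<bullet> q) + t\<^sup>2 * (q \<bullet> q)"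
      by (simp add: inner_add_left inner_add_right inner_commute[of q p] power2_eq_square algebra_simps)
    also have "\<dots> = L * (s + t * (m + 1 / 2))\<^sup>2 + H * t\<^sup>2"
    proof -
      have "L * (s\<^sup>2 * (p \<bullet> p) + 2 * (s * t) * (p \<bullet> q) + t\<^sup>2 * (q \<bullet> q)) = L * (L * (s + t * (m + 1 / 2))\<^sup>2 + H * t\<^sup>2)"
      proof -
        have HL: "L * H = d\<^sup>2" using L by (simp add: H_def)
        define n where "n = m + 1 / 2"
        have m'': "n * L = p \<bullet> q" using m' by (simp add: n_def)
        show ?thesis using HL d' m'' L' unfolding n_def[symmetric] by algebra
      qed
      then show ?thesis using L by simp
    qed
    finally have "dist (\<phi> u v) (\<phi> u' v') = sqrt (L * (s + t * (m + 1 / 2))\<^sup>2 + H * t\<^sup>2)"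
      by (simp add: real_sqrt_unique)
    then show ?thesis by (simp add: g_def s_def t_def)
  qed
  have inner: "(\<integral>\<^sup>+x. indicator (triangle P Q R) x * ennreal (k (dist x y)) \<partial>lborel)
    = ennreal \<bar>d\<bar> * (\<integral>\<^sup>+v. \<integral>\<^sup>+u. T u v * ennreal (k (dist (\<phi> u v) y)) \<partial>lborel \<partial>lborel)" for y
    unfolding d_def using d0
    by (subst nn_integral_affine_vec2[of _ "Q - P" "R - P" P]) (simp_all add: d_def T[unfolded \<phi>_def] \<phi>_def)
  have "kernel_energy (triangle P Q R)
    = ennreal \<bar>d\<bar> * (\<integral>\<^sup>+v'. \<integral>\<^sup>+u'. T u' v' * (ennreal \<bar>d\<bar> * (\<integral>\<^sup>+v. \<integral>\<^sup>+u. T u v * g (u - u') (v - v') \<partial>lborel \<partial>lborel)) \<partial>lborel \<partial>lborel)"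
  proof -
    have "kernel_energy (triangle P Q R) = ennreal \<bar>d\<bar> * (\<integral>\<^sup>+v'. \<integral>\<^sup>+u'. T u' v' *
        (\<integral>\<^sup>+x. indicator (triangle P Q R) x * ennreal (k (dist x (\<phi> u' v'))) \<partial>lborel) \<partial>lborel \<partial>lborel)"
      unfolding kernel_energy_def using d0
      by (subst nn_integral_affine_vec2[of _ "Q - P" "R - P" P]) (simp_all add: d_def T[unfolded \<phi>_def] \<phi>_def)
    then show ?thesis by (simp only: inner g)
  qed
  also have "\<dots> = ennreal \<bar>d\<bar> * (\<integral>\<^sup>+v'. \<integral>\<^sup>+u'. ennreal \<bar>d\<bar> * (\<integral>\<^sup>+v. \<integral>\<^sup>+u. T u v * T u' v' * g (u - u') (v - v') \<partial>lborel \<partial>lborel) \<partial>lborel \<partial>lborel)"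
    by (simp add: nn_integral_cmult[symmetric] mult_ac)
  also have "\<dots> = (ennreal \<bar>d\<bar>)\<^sup>2 * (\<integral>\<^sup>+v'. \<integral>\<^sup>+u'. \<integral>\<^sup>+v. \<integral>\<^sup>+u. T u v * T u' v' * g (u - u') (v - v') \<partial>lborel \<partial>lborel \<partial>lborel \<partial>lborel)"
    by (simp add: nn_integral_cmult power2_eq_square mult.assoc)
  \<comment> \<open>Both heights are moved outermost, so that the inner double integral runs over
    one pair of slices.\<close>
  also have "(\<integral>\<^sup>+v'. \<integral>\<^sup>+u'. \<integral>\<^sup>+v. \<integral>\<^sup>+u. T u v * T u' v' * g (u - u') (v - v') \<partial>lborel \<partial>lborel \<partial>lborel \<partial>lborel)
    = (\<integral>\<^sup>+v'. \<integral>\<^sup>+v. \<integral>\<^sup>+u'. \<integral>\<^sup>+u. T u v * T u' v' * g (u - u') (v - v') \<partial>lborel \<partial>lborel \<partial>lborel \<partial>lborel)"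
    by (intro nn_integral_cong lborel_pair.Fubini') measurable
  also have "\<dots> = (\<integral>\<^sup>+v. \<integral>\<^sup>+v'. \<integral>\<^sup>+u'. \<integral>\<^sup>+u. T u v * T u' v' * g (u - u') (v - v') \<partial>lborel \<partial>lborel \<partial>lborel \<partial>lborel)"
    by (rule lborel_pair.Fubini') measurable
  also have "\<dots> = shape_energy L H m"
    unfolding shape_energy_def
  proof (intro nn_integral_cong)
    fix v v' :: real
    have "(\<integral>\<^sup>+u'. \<integral>\<^sup>+u. T u v * T u' v' * g (u - u') (v - v') \<partial>lborel \<partial>lborel)
      = (\<integral>\<^sup>+u'. \<integral>\<^sup>+u. (indicator {0..1} v * indicator {0..1} v') * (indicator {0..1 - v} u * indicator {0..1 - v'} u' * g (u - u') (v - v')) \<partial>lborel \<partial>lborel)"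
      by (simp add: T_def mult_ac)
    also have "\<dots> = (indicator {0..1} v * indicator {0..1} v') * (\<integral>\<^sup>+u'. \<integral>\<^sup>+u. indicator {0..1 - v} u * indicator {0..1 - v'} u' * g (u - u') (v - v') \<partial>lborel \<partial>lborel)"
      by (simp add: nn_integral_cmult del: times_ennreal_def)
    also have "\<dots> = indicator {0..1} v * indicator {0..1} v' * slice_energy L H m v v'"
      unfolding g_def slice_energy_rows ..
    finally show "(\<integral>\<^sup>+u'. \<integral>\<^sup>+u. T u v * T u' v' * g (u - u') (v - v') \<partial>lborel \<partial>lborel)
      = indicator {0..1} v * indicator {0..1} v' * slice_energy L H m v v'" .
  qed
  finally show ?thesis by (simp add: H_def)
qed

end

section \<open>The energy along a slide of one vertex\<close>

context decreasing_kernel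
begin

text \<open>The additive constant contributes \<open>c\<close> times the squared area. Finiteness of
  the energy matters because a Bochner integral of a non-integrable function is 0 by convention; it
  makes the inner integral finite for almost every \<open>y\<close> in
  \<open>\<Omega>\<close>.\<close>

lemma D_energy_eq_kernel_energy:
  fixes \<Omega> :: "(real^2) set" and K :: "real \<Rightarrow> real" and c :: real
  assumes [measurable]: "\<Omega> \<in> sets borel" and fin: "emeasure lborel \<Omega> < \<infinity>"
    and K: "\<And>x y. x \<in> \<Omega> \<Longrightarrow> y \<in> \<Omega> \<Longrightarrow> x \<noteq> y \<Longrightarrow> K (dist x y) = k (dist x y) + c"
    and energy: "kernel_energy \<Omega> < \<infinity>"
  shows "D_energy K \<Omega> = enn2real (kernel_energy \<Omega>) + c * (measure lborel \<Omega>)\<^sup>2"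
proof -
  define \<mu> where "\<mu> = measure lborel \<Omega>"
  define G where "G y = (\<integral>\<^sup>+x. indicator \<Omega> x * ennreal (k (dist x y)) \<partial>lborel)" for y
  have [measurable]: "G \<in> borel_measurable borel"
    unfolding G_def by measurable
  \<comment> \<open>\<open>K'\<close> agrees with \<open>K (dist x y)\<close> for all pairs in
    \<open>\<Omega>\<close>, including the diagonal value \<open>K 0\<close>, and is measurable on
    the whole space.\<close>
  define K' where "K' x y = (if x = y then K 0 else k (dist x y) + c)" for x y :: "real^2"
  have [measurable]: "(\<lambda>p. K' (snd p) (fst p)) \<in> borel_measurable (borel \<Otimes>\<^sub>M borel)"
    unfolding K'_def by measurable
  have [measurable]: "(\<lambda>x. K' x y) \<in> borel_measurable borel" for y
    unfolding K'_def by measurable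
  have KK': "indicator \<Omega> y * (indicator \<Omega> x * K (dist x y)) = indicator \<Omega> y * (indicator \<Omega> x * K' x y)" for x y
    using K by (auto simp: K'_def split: split_indicator)
  have energy_G: "kernel_energy \<Omega> = (\<integral>\<^sup>+y. indicator \<Omega> y * G y \<partial>lborel)"
    by (simp add: kernel_energy_def G_def)
  have int_\<Omega>: "integrable lborel (indicator \<Omega> :: real^2 \<Rightarrow> real)"
    using fin by (simp add: integrable_indicator_iff)
  have inner: "(LINT x|lborel. indicator \<Omega> x * K' x y) = enn2real (G y) + c * \<mu>" if "G y \<noteq> \<infinity>" for y
  proof -
    have nn: "(\<integral>\<^sup>+x. ennreal (indicator \<Omega> x * k (dist x y)) \<partial>lborel) = G y"
      unfolding G_def by (intro nn_integral_cong) (simp split: split_indicator)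
    have int: "integrable lborel (\<lambda>x. indicator \<Omega> x * k (dist x y))"
      using that kernel_pos by (intro integrableI_nonneg) (auto simp: nn less_imp_le less_top)
    have "(LINT x|lborel. indicator \<Omega> x * K' x y) = (LINT x|lborel. indicator \<Omega> x * k (dist x y) + c * indicator \<Omega> x)"
    proof (rule integral_cong_AE)
      show "AE x in lborel. indicator \<Omega> x * K' x y = indicator \<Omega> x * k (dist x y) + c * indicator \<Omega> x"
        using AE_lborel_singleton[of y] by eventually_elim (simp add: K'_def split: split_indicator)
    qed measurable
    also have "\<dots> = (LINT x|lborel. indicator \<Omega> x * k (dist x y)) + c * \<mu>"
      using int int_\<Omega> by (simp add: \<mu>_def)
    also have "(LINT x|lborel. indicator \<Omega> x * k (dist x y)) = enn2real (G y)"
      using kernel_pos by (subst integral_eq_nn_integral) (auto simp: nn less_imp_le)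
    finally show ?thesis .
  qed
  have AE_fin: "AE y in lborel. indicator \<Omega> y * G y \<noteq> \<infinity>"
    using energy unfolding energy_G by (intro nn_integral_PInf_AE) (auto simp: less_top)
  have nn: "(\<integral>\<^sup>+y. ennreal (indicator \<Omega> y * enn2real (G y)) \<partial>lborel) = kernel_energy \<Omega>"
    unfolding energy_G
  proof (rule nn_integral_cong_AE)
    show "AE y in lborel. ennreal (indicator \<Omega> y * enn2real (G y)) = indicator \<Omega> y * G y"
      using AE_fin by eventually_elim (auto simp: less_top split: split_indicator)
  qed
  have int: "integrable lborel (\<lambda>y. indicator \<Omega> y * enn2real (G y))"
    using energy by (intro integrableI_nonneg) (auto simp: nn)
  have "D_energy K \<Omega> = (LINT y|lborel. indicator \<Omega> y * (LINT x|lborel. indicator \<Omega> x * K (dist x y)))"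
    by (simp add: D_energy_def set_lebesgue_integral_def)
  also have "\<dots> = (LINT y|lborel. indicator \<Omega> y * (LINT x|lborel. indicator \<Omega> x * K' x y))"
  proof (rule Bochner_Integration.integral_cong[OF refl])
    fix y :: "real^2"
    show "indicator \<Omega> y * (LINT x|lborel. indicator \<Omega> x * K (dist x y))
      = indicator \<Omega> y * (LINT x|lborel. indicator \<Omega> x * K' x y)"
    proof (cases "y \<in> \<Omega>")
      case True
      then have "indicator \<Omega> x * K (dist x y) = indicator \<Omega> x * K' x y" for x
        using KK'[of y x] by simp
      then show ?thesis by presburger
    qed simp
  qed
  also have "\<dots> = (LINT y|lborel. indicator \<Omega> y * enn2real (G y) + (c * \<mu>) * indicator \<Omega> y)"
  proof (rule integral_cong_AE)
    show "AE y in lborel. indicator \<Omega> y * (LINT x|lborel. indicator \<Omega> x * K' x y)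
      = indicator \<Omega> y * enn2real (G y) + (c * \<mu>) * indicator \<Omega> y"
      using AE_fin by eventually_elim (auto simp: inner split: split_indicator)
    show "(\<lambda>y. indicator \<Omega> y * (LINT x|lborel. indicator \<Omega> x * K' x y)) \<in> borel_measurable lborel"
      by measurable
    show "(\<lambda>y. indicator \<Omega> y * enn2real (G y) + (c * \<mu>) * indicator \<Omega> y) \<in> borel_measurable lborel"
      by measurable
  qed
  also have "\<dots> = enn2real (kernel_energy \<Omega>) + (c * \<mu>) * \<mu>"
  proof -
    have "(LINT y|lborel. indicator \<Omega> y * enn2real (G y)) = enn2real (kernel_energy \<Omega>)"
      by (subst integral_eq_nn_integral) (auto simp: nn)
    then show ?thesis using int int_\<Omega> by (simp add: \<mu>_def)
  qed
  finally show ?thesis by (simp add: \<mu>_def power2_eq_square mult.assoc)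
qed

end

text \<open>Subtracting \<open>K M - 1\<close> makes the kernel at least 1 on \<open>(0, M]\<close>;
  beyond \<open>M\<close> it continues as \<open>exp (M - r) < 1\<close>, so strict decrease
  survives the junction. With \<open>M\<close> no smaller than the diameter, the energy never meets
  the continuation.\<close>

lemma decreasing_kernel_truncation:
  fixes K :: "real \<Rightarrow> real" and M :: real
  assumes cont: "continuous_on {0<..} K"
    and dec: "strict_antimono_on {0<..} K"
    and int: "set_integrable lborel {0<..<1} (\<lambda>r. K r * r)"
    and M: "0 < M"
  obtains k where "decreasing_kernel k" "\<And>r. 0 < r \<Longrightarrow> r \<le> M \<Longrightarrow> K r = k r + (K M - 1)"
proof -
  \<comment> \<open>The indicator factor does not change the value in this branch; it makes the
    expression measurable, \<open>K\<close> being continuous on positive numbers only.\<close>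
  define k where "k r = (if 0 < r \<and> r \<le> M then indicator {0<..} r * K r - K M + 1 else if M < r then exp (M - r) else 1)" for r
  have K_less: "K s < K r" if "0 < r" "r < s" for r s
    using monotone_onD[OF dec, of r s] that by simp
  have K_le: "K M \<le> K r" if "0 < r" "r \<le> M" for r
    using K_less[of r M] that by (cases "r = M") auto
  have [measurable]: "(\<lambda>r. indicator {0<..} r * K r) \<in> borel_measurable borel"
    using borel_measurable_continuous_on_indicator[OF _ cont] by simp
  have [measurable]: "k \<in> borel_measurable borel"
    unfolding k_def by measurable
  have k_pos: "0 < k r" for r
    using K_le by (auto simp: k_def add.commute add_pos_nonneg)
  have int': "(\<integral>\<^sup>+r. ennreal \<bar>indicator {0<..<1} r * (K r * r)\<bar> \<partial>lborel) < \<infinity>"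
    using int by (simp add: set_integrable_def integrable_iff_bounded)
  have "decreasing_kernel k"
  proof
    show "k s < k r" if "0 < r" "r < s" for r s
    proof -
      consider "s \<le> M" | "r \<le> M" "M < s" | "M < r" using that by linarith
      then show ?thesis
      proof cases
        case 2
        then have "k s < 1" using that M by (simp add: k_def)
        also have "1 \<le> k r" using 2 that K_le by (simp add: k_def)
        finally show ?thesis .
      qed (use that K_less M in \<open>auto simp: k_def\<close>)
    qed
    have "(\<integral>\<^sup>+r. indicator {0<..<1} r * ennreal (k r * r) \<partial>lborel)
      \<le> (\<integral>\<^sup>+r. ennreal \<bar>indicator {0<..<1} r * (K r * r)\<bar> + ennreal (\<bar>K M\<bar> + 1) * indicator {0<..<1} r \<partial>lborel)"
    proof (rule nn_integral_mono)
      fix r :: real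
      show "indicator {0<..<1} r * ennreal (k r * r)
        \<le> ennreal \<bar>indicator {0<..<1} r * (K r * r)\<bar> + ennreal (\<bar>K M\<bar> + 1) * indicator {0<..<1} r"
      proof (cases "r \<in> {0<..<1}")
        case True
        have "k r \<le> \<bar>K r\<bar> + (\<bar>K M\<bar> + 1)"
        proof (cases "r \<le> M")
          case False
          then have "k r \<le> 1" by (simp add: k_def)
          then show ?thesis by simp
        qed (use True in \<open>auto simp: k_def\<close>)
        then have "k r * r \<le> (\<bar>K r\<bar> + (\<bar>K M\<bar> + 1)) * r" using True by (intro mult_right_mono) auto
        also have "\<dots> \<le> \<bar>K r * r\<bar> + (\<bar>K M\<bar> + 1)"
          using True mult_left_le[of r "\<bar>K M\<bar> + 1"] by (simp add: abs_mult distrib_right)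
        finally have "ennreal (k r * r) \<le> ennreal (\<bar>K r * r\<bar> + (\<bar>K M\<bar> + 1))" by (rule ennreal_leI)
        also have "\<dots> = ennreal \<bar>K r * r\<bar> + ennreal (\<bar>K M\<bar> + 1)" by (intro ennreal_plus) auto
        finally show ?thesis using True by simp
      qed simp
    qed
    also have "\<dots> = (\<integral>\<^sup>+r. ennreal \<bar>indicator {0<..<1} r * (K r * r)\<bar> \<partial>lborel) + ennreal (\<bar>K M\<bar> + 1)"
    proof -
      have "(\<lambda>r. indicator {0<..<1} r * (K r * r)) \<in> borel_measurable borel"
        using int by (simp add: set_integrable_def borel_measurable_integrable)
      then show ?thesis
        by (subst nn_integral_add) (auto simp: nn_integral_cmult_indicator simp del: ennreal_plus)
    qed
    also have "\<dots> < \<infinity>" using int' by simp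
    finally show "(\<integral>\<^sup>+r. indicator {0<..<1} r * ennreal (k r * r) \<partial>lborel) < \<infinity>" .
  qed (use k_pos in auto)
  moreover have "K r = k r + (K M - 1)" if "0 < r" "r \<le> M" for r
    using that by (simp add: k_def)
  ultimately show ?thesis by (rule that)
qed

text \<open>By polarisation, the difference of the squared sides at the apex divided by
  \<open>2 L\<close> is the parameter \<open>m\<close>. Formulating the result through distances
  makes it independent of position, so the equality case also covers congruent triangles.\<close>

lemma
  fixes K :: "real \<Rightarrow> real" and P Q R P' Q' R' :: "real^2"
  assumes K: "continuous_on {0<..} K" "strict_antimono_on {0<..} K"
      "set_integrable lborel {0<..<1} (\<lambda>r. K r * r)"
    and base: "dist P Q = dist P' Q'"
    and area: "\<bar>cross2 (Q - P) (R - P)\<bar> = \<bar>cross2 (Q' - P') (R' - P')\<bar>" "cross2 (Q - P) (R - P) \<noteq> 0"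
  shows D_energy_slide_eq: "\<bar>(dist P R)\<^sup>2 - (dist Q R)\<^sup>2\<bar> = \<bar>(dist P' R')\<^sup>2 - (dist Q' R')\<^sup>2\<bar> \<Longrightarrow>
      D_energy K (triangle P' Q' R') = D_energy K (triangle P Q R)"
    and D_energy_slide_less: "\<bar>(dist P R)\<^sup>2 - (dist Q R)\<^sup>2\<bar> < \<bar>(dist P' R')\<^sup>2 - (dist Q' R')\<^sup>2\<bar> \<Longrightarrow>
      D_energy K (triangle P' Q' R') < D_energy K (triangle P Q R)"
proof -
  \<comment> \<open>One \<open>M\<close> for both triangles, so that the same kernel and the same
    constant serve both; the entry 1 ensures positivity.\<close>
  define M where "M = max (diameter (triangle P Q R)) (max (diameter (triangle P' Q' R')) 1)"
  have M: "0 < M" by (simp add: M_def)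
  obtain k where k: "decreasing_kernel k" and Kk: "\<And>r. 0 < r \<Longrightarrow> r \<le> M \<Longrightarrow> K r = k r + (K M - 1)"
    using decreasing_kernel_truncation[OF K M] by blast
  interpret decreasing_kernel k by (rule k)
  define L where "L = (dist P Q)\<^sup>2"
  define d where "d = \<bar>cross2 (Q - P) (R - P)\<bar>"
  define \<mu> where "\<mu> = measure lborel (triangle P Q R)"
  define off where "off P Q R = ((dist P R)\<^sup>2 - (dist Q R)\<^sup>2) / (2 * L)" for P Q R :: "real^2"
  have d: "0 < d" using area by (simp add: d_def)
  have "P \<noteq> Q" using area by (auto simp: cross2_def)
  then have L: "0 < L" by (simp add: L_def)
  have E: "kernel_energy (triangle P Q R) = (ennreal d)\<^sup>2 * shape_energy L (d\<^sup>2 / L) (off P Q R)"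
    if "(dist P Q)\<^sup>2 = L" "\<bar>cross2 (Q - P) (R - P)\<bar> = d" for P Q R
  proof -
    have "((Q - P) \<bullet> (R - P)) / L - 1 / 2 = off P Q R"
    proof -
      have "2 * ((Q - P) \<bullet> (R - P)) = (dist P R)\<^sup>2 - (dist Q R)\<^sup>2 + L"
        unfolding that(1)[symmetric] dist_norm power2_norm_eq_inner
        by (simp add: inner_diff_left inner_diff_right inner_commute)
      then show ?thesis using L by (simp add: off_def field_simps)
    qed
    moreover have "cross2 (Q - P) (R - P) \<noteq> 0" "(cross2 (Q - P) (R - P))\<^sup>2 = d\<^sup>2"
      using that d by (auto simp flip: that(2))
    ultimately show ?thesis using kernel_energy_triangle[of Q P R] that by simp
  qed
  have fin: "(ennreal d)\<^sup>2 * shape_energy L (d\<^sup>2 / L) m < \<infinity>" for m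
    using shape_energy_finite[OF L, of "d\<^sup>2 / L" m] L d by (simp add: ennreal_mult_less_top power2_eq_square)
  have D: "D_energy K (triangle P Q R) = enn2real (kernel_energy (triangle P Q R)) + (K M - 1) * \<mu>\<^sup>2"
    if "(dist P Q)\<^sup>2 = L" "\<bar>cross2 (Q - P) (R - P)\<bar> = d" "diameter (triangle P Q R) \<le> M" for P Q R
  proof -
    have "measure lborel (triangle P Q R) = \<mu>"
      unfolding \<mu>_def using that d by (intro measure_triangle_eq) (auto simp: d_def)
    moreover have "K (dist x y) = k (dist x y) + (K M - 1)"
      if "x \<in> triangle P Q R" "y \<in> triangle P Q R" "x \<noteq> y" for x y
      using that diameter_bounded_bound[OF compact_imp_bounded[OF compact_triangle], of x P Q R y] \<open>diameter (triangle P Q R) \<le> M\<close>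
      by (intro Kk) auto
    ultimately show ?thesis
      using fin emeasure_compact_finite[OF compact_triangle] E[OF that(1,2)]
      by (subst D_energy_eq_kernel_energy[where c = "K M - 1"]) auto
  qed
  have hyps: "(dist P Q)\<^sup>2 = L" "\<bar>cross2 (Q - P) (R - P)\<bar> = d" "diameter (triangle P Q R) \<le> M"
    "(dist P' Q')\<^sup>2 = L" "\<bar>cross2 (Q' - P') (R' - P')\<bar> = d" "diameter (triangle P' Q' R') \<le> M"
    using base area by (auto simp: L_def d_def M_def)
  have abs_off: "\<bar>off P Q R\<bar> = \<bar>(dist P R)\<^sup>2 - (dist Q R)\<^sup>2\<bar> / (2 * L)" for P Q R
    using L by (simp add: off_def)
  have H: "0 < d\<^sup>2 / L" using L d by simp
  show "D_energy K (triangle P' Q' R') = D_energy K (triangle P Q R)"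
    if "\<bar>(dist P R)\<^sup>2 - (dist Q R)\<^sup>2\<bar> = \<bar>(dist P' R')\<^sup>2 - (dist Q' R')\<^sup>2\<bar>"
    using that shape_energy_cong[OF L H, of "off P Q R" "off P' Q' R'"]
    by (simp add: D[OF hyps(1-3)] D[OF hyps(4-6)] E[OF hyps(1,2)] E[OF hyps(4,5)] abs_off)
  assume "\<bar>(dist P R)\<^sup>2 - (dist Q R)\<^sup>2\<bar> < \<bar>(dist P' R')\<^sup>2 - (dist Q' R')\<^sup>2\<bar>"
  then have "\<bar>off P Q R\<bar> < \<bar>off P' Q' R'\<bar>"
    using L by (simp add: abs_off divide_strict_right_mono)
  then have "shape_energy L (d\<^sup>2 / L) (off P' Q' R') < shape_energy L (d\<^sup>2 / L) (off P Q R)"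
    using shape_energy_finite[OF L H] by (intro shape_energy_less[OF L H]) (auto simp: less_top)
  then have "(ennreal d)\<^sup>2 * shape_energy L (d\<^sup>2 / L) (off P' Q' R') < (ennreal d)\<^sup>2 * shape_energy L (d\<^sup>2 / L) (off P Q R)"
    using d by (intro ennreal_mult_strict_left_mono) (auto simp: power2_eq_square ennreal_mult_less_top ennreal_zero_less_mult_iff)
  then have "enn2real (kernel_energy (triangle P' Q' R')) < enn2real (kernel_energy (triangle P Q R))"
    using fin by (simp add: E[OF hyps(1,2)] E[OF hyps(4,5)] enn2real_less_iff)
  then show "D_energy K (triangle P' Q' R') < D_energy K (triangle P Q R)"
    by (simp add: D[OF hyps(1-3)] D[OF hyps(4-6)])
qed

section \<open>Decomposing the deformation into two slides\<close>

lemma dist_vec2_squared: "(dist p q)\<^sup>2 = (p $ 1 - q $ 1)\<^sup>2 + (p $ 2 - q $ 2)\<^sup>2" for p q :: "real^2"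
  unfolding dist_norm power2_norm_eq_inner by (simp add: inner_vec_def sum_2 power2_eq_square)

definition std_triangle :: "real \<Rightarrow> real \<Rightarrow> real \<Rightarrow> (real^2) set" where
  "std_triangle a b c = triangle (vector [- a, 0]) (vector [b, 0]) (vector [0, c])"

context
  fixes K :: "real \<Rightarrow> real"
  assumes K: "continuous_on {0<..} K" "strict_antimono_on {0<..} K"
      "set_integrable lborel {0<..<1} (\<lambda>r. K r * r)"
begin

lemma D_energy_slide_le:
  fixes P Q R P' Q' R' :: "real^2"
  assumes "dist P Q = dist P' Q'"
    and "\<bar>cross2 (Q - P) (R - P)\<bar> = \<bar>cross2 (Q' - P') (R' - P')\<bar>" "cross2 (Q - P) (R - P) \<noteq> 0"
    and "\<bar>(dist P R)\<^sup>2 - (dist Q R)\<^sup>2\<bar> \<le> \<bar>(dist P' R')\<^sup>2 - (dist Q' R')\<^sup>2\<bar>"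
  shows "D_energy K (triangle P' Q' R') \<le> D_energy K (triangle P Q R)"
  using assms(4) D_energy_slide_less[OF K assms(1-3)] D_energy_slide_eq[OF K assms(1-3)] by linarith

text \<open>\<open>A\<close> may lie on either side of the origin. Invariance under the reflection
  is the equality case of a slide: base, area and distance to the bisector agree.\<close>

lemma D_energy_std_triangle:
  fixes A B C :: "real^2"
  assumes "A $ 2 = 0" "B $ 2 = 0" "C $ 1 = 0" "A $ 1 * B $ 1 < 0" "C $ 2 > 0"
  shows "D_energy K (triangle A B C) = D_energy K (std_triangle \<bar>A $ 1\<bar> \<bar>B $ 1\<bar> (C $ 2))"
  unfolding std_triangle_def
proof (rule D_energy_slide_eq[OF K, symmetric])
  have ab: "\<bar>A $ 1 - B $ 1\<bar> = \<bar>A $ 1\<bar> + \<bar>B $ 1\<bar>"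
    using assms(4) by (auto simp: mult_less_0_iff)
  then have sq: "(A $ 1 - B $ 1)\<^sup>2 = (\<bar>A $ 1\<bar> + \<bar>B $ 1\<bar>)\<^sup>2"
    by (metis power2_abs)
  have "(dist A B)\<^sup>2 = (dist (vector [- \<bar>A $ 1\<bar>, 0]) (vector [\<bar>B $ 1\<bar>, 0] :: real^2))\<^sup>2"
    using assms sq by (simp add: dist_vec2_squared) (simp add: power2_eq_square algebra_simps)
  then show "dist A B = dist (vector [- \<bar>A $ 1\<bar>, 0]) (vector [\<bar>B $ 1\<bar>, 0] :: real^2)"
    by simp
  have "\<bar>cross2 (B - A) (C - A)\<bar> = \<bar>A $ 1 - B $ 1\<bar> * C $ 2"
    using assms by (simp add: cross2_def abs_mult abs_minus_commute)
  then show "\<bar>cross2 (B - A) (C - A)\<bar> = \<bar>cross2 (vector [\<bar>B $ 1\<bar>, 0] - vector [- \<bar>A $ 1\<bar>, 0]) (vector [0, C $ 2] - vector [- \<bar>A $ 1\<bar>, 0] :: real^2)\<bar>"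
    using assms(5) by (simp add: cross2_def ab abs_mult add.commute)
  show "cross2 (B - A) (C - A) \<noteq> 0"
    using assms by (auto simp: cross2_def mult_less_0_iff)
  show "\<bar>(dist A C)\<^sup>2 - (dist B C)\<^sup>2\<bar> = \<bar>(dist (vector [- \<bar>A $ 1\<bar>, 0]) (vector [0, C $ 2] :: real^2))\<^sup>2 - (dist (vector [\<bar>B $ 1\<bar>, 0]) (vector [0, C $ 2] :: real^2))\<^sup>2\<bar>"
    using assms by (simp add: dist_vec2_squared)
qed

lemma D_energy_mirror:
  assumes "0 < a" "0 < b" "0 < c"
  shows "D_energy K (std_triangle a b c) = D_energy K (std_triangle b a c)"
  unfolding std_triangle_def
proof (rule D_energy_slide_eq[OF K])
  have "(dist (vector [- b, 0]) (vector [a, 0] :: real^2))\<^sup>2 = (dist (vector [- a, 0]) (vector [b, 0] :: real^2))\<^sup>2"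
    unfolding dist_vec2_squared by simp algebra
  then show "dist (vector [- b, 0]) (vector [a, 0] :: real^2) = dist (vector [- a, 0]) (vector [b, 0] :: real^2)"
    by simp
qed (use assms in \<open>simp_all add: cross2_def dist_vec2_squared add.commute abs_minus_commute\<close>)

text \<open>
  Here \<open>r\<^sup>2 = w / w'\<close> is the ratio of the parameters \<open>w = 1 + t\<close>. The intermediate triangle has the side
  \<open>BC\<close> of the first triangle and the side \<open>AB\<close> of the last one; \<open>(a + b) * s\<close> is the inner product of
  the vectors from \<open>B\<close> to its two other vertices.
\<close>

lemma D_energy_two_slides:
  assumes pos: "0 < a" "0 < b" "0 < c" and r: "0 < r" "r < 1"
    and s: "0 \<le> s" "s\<^sup>2 = (b\<^sup>2 + c\<^sup>2) * r\<^sup>2 - c\<^sup>2"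
    and slide1: "c\<^sup>2 < a * b + (a + b) * s"
    and slide2: "\<bar>b - a\<bar> * r\<^sup>2 \<le> \<bar>2 * s - (a + b) * r\<^sup>2\<bar>"
  shows "D_energy K (std_triangle a b c) < D_energy K (std_triangle (a * r) (b * r) (c / r))"
proof -
  define l where "l = sqrt (b\<^sup>2 + c\<^sup>2)"
  have l: "0 < l" "l\<^sup>2 = b\<^sup>2 + c\<^sup>2" using pos by (auto simp: l_def add_pos_pos)
  \<comment> \<open>Coordinates of the slid vertex when \<open>BC\<close> is laid along the axis
    with \<open>B\<close> at 0: \<open>h\<close> is fixed by the area, and \<open>p\<close> is
    chosen so that its distance from \<open>B\<close> becomes \<open>(a + b) * r\<close>.\<close>
  define p h where "p = (a + b) * s / l" and "h = c * (a + b) / l"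
  have pl: "p * l = (a + b) * s" and hl: "h * l = c * (a + b)" using l by (auto simp: p_def h_def)
  have ph: "p\<^sup>2 + h\<^sup>2 = ((a + b) * r)\<^sup>2"
  proof -
    have "(p\<^sup>2 + h\<^sup>2) * l\<^sup>2 = ((a + b) * r)\<^sup>2 * l\<^sup>2"
      using pl hl s(2) l(2) by algebra
    then show ?thesis using l(1) by simp
  qed
  define A B C :: "real^2" where "A = vector [- a, 0]" and "B = vector [b, 0]" and "C = vector [0, c]"
  define A1 B1 C1 :: "real^2" where "A1 = vector [p, h]" and "B1 = vector [0, 0]" and "C1 = vector [l, 0]"
  define A2 B2 C2 :: "real^2" where "A2 = vector [- (a * r), 0]" and "B2 = vector [b * r, 0]" and "C2 = vector [0, c / r]"
  note defs = A_def B_def C_def A1_def B1_def C1_def A2_def B2_def C2_def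
  have area: "0 < c * (a + b)" using pos by simp
  \<comment> \<open>At \<open>r = 1\<close> one would have \<open>s = b\<close>, the original
    position of \<open>A\<close>; shortening \<open>AB\<close> moves the foot on \<open>BC\<close>
    towards \<open>B\<close>.\<close>
  have sb: "s < b"
  proof -
    have "r\<^sup>2 < 1" using r by (simp add: power_less_one_iff)
    then have "(b\<^sup>2 + c\<^sup>2) * r\<^sup>2 < (b\<^sup>2 + c\<^sup>2) * 1"
      using pos by (intro mult_strict_left_mono) (auto simp: add_pos_pos)
    then have "s\<^sup>2 < b\<^sup>2" unfolding s(2) by simp
    then show ?thesis by (rule power2_less_imp_less) (use pos in simp)
  qed
  have "D_energy K (triangle B C A) < D_energy K (triangle B1 C1 A1)"
  proof (rule D_energy_slide_less[OF K])
    have "(dist B1 C1)\<^sup>2 = (dist B C)\<^sup>2" using l by (simp add: defs dist_vec2_squared)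
    then show "dist B1 C1 = dist B C" by simp
    have cr: "cross2 (C1 - B1) (A1 - B1) = c * (a + b)" "cross2 (C - B) (A - B) = c * (a + b)"
      using hl by (simp_all add: defs cross2_def algebra_simps)
    show "\<bar>cross2 (C1 - B1) (A1 - B1)\<bar> = \<bar>cross2 (C - B) (A - B)\<bar>" by (simp add: cr)
    show "cross2 (C1 - B1) (A1 - B1) \<noteq> 0" using area unfolding cr by (rule less_imp_neq[THEN not_sym])
    have o1: "(dist B1 A1)\<^sup>2 - (dist C1 A1)\<^sup>2 = 2 * ((a + b) * s) - (b\<^sup>2 + c\<^sup>2)"
    proof -
      have "(dist B1 A1)\<^sup>2 - (dist C1 A1)\<^sup>2 = 2 * (p * l) - l\<^sup>2"
        unfolding dist_vec2_squared defs by (simp add: power2_eq_square algebra_simps)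
      then show ?thesis unfolding pl l(2) .
    qed
    have o2: "(dist B A)\<^sup>2 - (dist C A)\<^sup>2 = b\<^sup>2 + 2 * (a * b) - c\<^sup>2"
      unfolding dist_vec2_squared defs by (simp add: power2_eq_square algebra_simps)
    \<comment> \<open>The two bounds say that the new vertex lies strictly between \<open>A\<close>
      and its mirror image in the bisector of \<open>BC\<close>: \<open>s < b\<close> excludes one
      end and \<open>slide1\<close> the other.\<close>
    have "(a + b) * s < (a + b) * b" using sb pos by simp
    then have "2 * ((a + b) * s) - (b\<^sup>2 + c\<^sup>2) < b\<^sup>2 + 2 * (a * b) - c\<^sup>2"
      by (simp add: power2_eq_square algebra_simps)
    moreover have "- (2 * ((a + b) * s) - (b\<^sup>2 + c\<^sup>2)) < b\<^sup>2 + 2 * (a * b) - c\<^sup>2"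
      using slide1 by linarith
    ultimately show "\<bar>(dist B1 A1)\<^sup>2 - (dist C1 A1)\<^sup>2\<bar> < \<bar>(dist B A)\<^sup>2 - (dist C A)\<^sup>2\<bar>"
      unfolding o1 o2 by linarith
  qed
  also have "triangle B C A = std_triangle a b c"
    by (simp add: triangle_def std_triangle_def defs insert_commute)
  also have "triangle B1 C1 A1 = triangle A1 B1 C1"
    by (simp add: triangle_def insert_commute)
  also have "D_energy K (triangle A1 B1 C1) \<le> D_energy K (triangle A2 B2 C2)"
  proof (rule D_energy_slide_le)
    have "(dist A2 B2)\<^sup>2 = (dist A1 B1)\<^sup>2"
      using ph unfolding dist_vec2_squared defs by (simp add: power2_eq_square algebra_simps)
    then show "dist A2 B2 = dist A1 B1" by simp
    have cr: "cross2 (B2 - A2) (C2 - A2) = c * (a + b)" "cross2 (B1 - A1) (C1 - A1) = c * (a + b)"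
      using hl r by (simp_all add: defs cross2_def field_simps)
    show "\<bar>cross2 (B2 - A2) (C2 - A2)\<bar> = \<bar>cross2 (B1 - A1) (C1 - A1)\<bar>" by (simp add: cr)
    show "cross2 (B2 - A2) (C2 - A2) \<noteq> 0" using area unfolding cr by (rule less_imp_neq[THEN not_sym])
    have o2: "(dist A2 C2)\<^sup>2 - (dist B2 C2)\<^sup>2 = - ((a + b) * ((b - a) * r\<^sup>2))"
      unfolding dist_vec2_squared defs by (simp add: power2_eq_square algebra_simps)
    have o1: "(dist A1 C1)\<^sup>2 - (dist B1 C1)\<^sup>2 = - ((a + b) * (2 * s - (a + b) * r\<^sup>2))"
    proof -
      have "(dist A1 C1)\<^sup>2 - (dist B1 C1)\<^sup>2 = (p\<^sup>2 + h\<^sup>2) - 2 * (p * l)"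
        unfolding dist_vec2_squared defs by (simp add: power2_eq_square algebra_simps)
      then show ?thesis unfolding pl ph by (simp add: power2_eq_square algebra_simps)
    qed
    have "(a + b) * (\<bar>b - a\<bar> * r\<^sup>2) \<le> (a + b) * \<bar>2 * s - (a + b) * r\<^sup>2\<bar>"
      using slide2 pos by (intro mult_left_mono) auto
    then show "\<bar>(dist A2 C2)\<^sup>2 - (dist B2 C2)\<^sup>2\<bar> \<le> \<bar>(dist A1 C1)\<^sup>2 - (dist B1 C1)\<^sup>2\<bar>"
      unfolding o1 o2 using pos by (simp add: abs_mult)
  qed
  finally show ?thesis by (simp add: std_triangle_def defs)
qed

text \<open>The difference \<open>s^2 - (b r^2)^2\<close> factors as
  \<open>(1 - r^2) (b^2 r^2 - c^2)\<close>, so \<open>low\<close> yields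
  \<open>s \<ge> b r^2\<close>: on the final base the intermediate apex is at least as far from the
  bisector as the final one, on the same side. The condition \<open>slide1\<close> also follows,
  from \<open>c^2 \<le> b^2 r^2 \<le> b s\<close>.\<close>

lemma D_energy_step_low:
  assumes pos: "0 < a" "a \<le> b" "0 < c" and r: "0 < r" "r < 1" and low: "c\<^sup>2 \<le> b\<^sup>2 * r\<^sup>2"
  shows "D_energy K (std_triangle a b c) < D_energy K (std_triangle (a * r) (b * r) (c / r))"
proof -
  have b: "0 < b" using pos by simp
  define s where "s = sqrt ((b\<^sup>2 + c\<^sup>2) * r\<^sup>2 - c\<^sup>2)"
  have r2: "0 < r\<^sup>2" "r\<^sup>2 < 1" using r by (auto simp: power_less_one_iff)
  have "0 \<le> (1 - r\<^sup>2) * (b\<^sup>2 * r\<^sup>2 - c\<^sup>2)" using r2 low by (intro mult_nonneg_nonneg) auto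
  then have "(b * r\<^sup>2)\<^sup>2 \<le> (b\<^sup>2 + c\<^sup>2) * r\<^sup>2 - c\<^sup>2"
    by (simp add: power2_eq_square algebra_simps)
  moreover from this have "0 \<le> (b\<^sup>2 + c\<^sup>2) * r\<^sup>2 - c\<^sup>2"
    by (rule order_trans[OF zero_le_power2])
  ultimately have brs: "b * r\<^sup>2 \<le> s" and s2: "s\<^sup>2 = (b\<^sup>2 + c\<^sup>2) * r\<^sup>2 - c\<^sup>2"
    unfolding s_def by (auto intro: real_le_rsqrt)
  have s: "0 \<le> s" using brs b r2 by (meson mult_pos_pos less_le_trans less_imp_le)
  show ?thesis
  proof (rule D_energy_two_slides[OF pos(1) b pos(3) r s s2])
    have "b\<^sup>2 * r\<^sup>2 \<le> b * s" using brs b by (simp add: power2_eq_square mult.assoc)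
    moreover have "0 < a * b" "0 \<le> a * s" using pos b s by auto
    ultimately show "c\<^sup>2 < a * b + (a + b) * s" using low by (simp add: distrib_right)
    show "\<bar>b - a\<bar> * r\<^sup>2 \<le> \<bar>2 * s - (a + b) * r\<^sup>2\<bar>"
      using brs pos by (simp add: algebra_simps)
  qed
qed

text \<open>The construction is applied to the mirror image. Now \<open>high\<close> gives
  \<open>s \<le> a r^2\<close>, which again puts the intermediate apex beyond the final one. That
  the intermediate triangle exists (\<open>rad\<close>) and that the other slide approaches its
  bisector (\<open>slide\<close>) must be supplied here.\<close>

lemma D_energy_step_high:
  assumes pos: "0 < a" "a \<le> b" "0 < c" and r: "0 < r" "r < 1" and high: "a\<^sup>2 * r\<^sup>2 \<le> c\<^sup>2"
    and rad: "0 \<le> (a\<^sup>2 + c\<^sup>2) * r\<^sup>2 - c\<^sup>2"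
    and slide: "c\<^sup>2 < a * b + (a + b) * sqrt ((a\<^sup>2 + c\<^sup>2) * r\<^sup>2 - c\<^sup>2)"
  shows "D_energy K (std_triangle a b c) < D_energy K (std_triangle (a * r) (b * r) (c / r))"
proof -
  have b: "0 < b" using pos by simp
  define s where "s = sqrt ((a\<^sup>2 + c\<^sup>2) * r\<^sup>2 - c\<^sup>2)"
  have s: "0 \<le> s" "s\<^sup>2 = (a\<^sup>2 + c\<^sup>2) * r\<^sup>2 - c\<^sup>2" using rad by (auto simp: s_def)
  have r2: "0 < r\<^sup>2" "r\<^sup>2 < 1" using r by (auto simp: power_less_one_iff)
  have "0 \<le> (1 - r\<^sup>2) * (c\<^sup>2 - a\<^sup>2 * r\<^sup>2)" using r2 high by (intro mult_nonneg_nonneg) auto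
  then have "s\<^sup>2 \<le> (a * r\<^sup>2)\<^sup>2"
    unfolding s(2) by (simp add: power2_eq_square algebra_simps)
  then have sar: "s \<le> a * r\<^sup>2" by (rule power2_le_imp_le) (use pos r2 in simp)
  have "D_energy K (std_triangle b a c) < D_energy K (std_triangle (b * r) (a * r) (c / r))"
  proof (rule D_energy_two_slides[OF b pos(1,3) r s])
    show "c\<^sup>2 < b * a + (b + a) * s"
      using slide[folded s_def] unfolding mult.commute[of b a] add.commute[of b a] .
    have "(b - a) * r\<^sup>2 \<le> (b + a) * r\<^sup>2 - 2 * s" using sar by (simp add: algebra_simps)
    also have "\<dots> \<le> \<bar>2 * s - (b + a) * r\<^sup>2\<bar>"
      unfolding abs_minus_commute[of "2 * s"] by (rule abs_ge_self)
    finally show "\<bar>a - b\<bar> * r\<^sup>2 \<le> \<bar>2 * s - (b + a) * r\<^sup>2\<bar>" using pos by simp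
  qed
  moreover have "D_energy K (std_triangle a b c) = D_energy K (std_triangle b a c)"
    using pos b by (intro D_energy_mirror)
  moreover have "D_energy K (std_triangle (a * r) (b * r) (c / r)) = D_energy K (std_triangle (b * r) (a * r) (c / r))"
    using pos b r by (intro D_energy_mirror) simp_all
  ultimately show ?thesis by (simp only:)
qed

end

section \<open>Monotonicity along the normalised family\<close>

context
  fixes K :: "real \<Rightarrow> real" and a b c :: real
  assumes K: "continuous_on {0<..} K" "strict_antimono_on {0<..} K"
      "set_integrable lborel {0<..<1} (\<lambda>r. K r * r)"
    and pos: "0 < a" "a \<le> b" "0 < c"
begin

definition family_energy :: "real \<Rightarrow> real" where
  "family_energy w = D_energy K (std_triangle (a / sqrt w) (b / sqrt w) (c * sqrt w))"

lemma family_energy_rescale: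
  assumes "0 < w" "0 < w'"
  defines "r \<equiv> sqrt w / sqrt w'"
  shows "family_energy w' = D_energy K (std_triangle (a / sqrt w * r) (b / sqrt w * r) (c * sqrt w / r))"
  using assms(1,2) by (simp add: family_energy_def r_def)

text \<open>At \<open>w = b / c\<close> the height \<open>c * sqrt w\<close> reaches the rescaled
  \<open>|OB|\<close>. Below it, \<open>(c w) (c w') \<le> b^2\<close> is the hypothesis
  \<open>low\<close> with \<open>r^2 = w / w'\<close>, so steps of any size are allowed.\<close>

lemma family_energy_less_low:
  assumes w: "0 < w" "w < w'" "w' \<le> b / c"
  shows "family_energy w < family_energy w'"
proof -
  define r where "r = sqrt w / sqrt w'"
  have r: "0 < r" "r < 1" using w by (simp_all add: r_def)
  have "c * w' \<le> b" using w pos by (simp add: field_simps)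
  moreover have "c * w \<le> c * w'" using w pos by simp
  ultimately have "c * w \<le> b" "c * w' \<le> b" by simp_all
  then have "(c * w) * (c * w') \<le> b * b" using w pos by (intro mult_mono) auto
  then have "c\<^sup>2 * w \<le> b\<^sup>2 / w'" using w by (simp add: power2_eq_square field_simps)
  also have "b\<^sup>2 / w' = (b / sqrt w)\<^sup>2 * r\<^sup>2" using w by (simp add: r_def power_divide)
  finally have "(c * sqrt w)\<^sup>2 \<le> (b / sqrt w)\<^sup>2 * r\<^sup>2" using w by (simp add: power_mult_distrib)
  then show ?thesis
    unfolding family_energy_rescale[OF w(1) less_trans[OF w(1,2)]] r_def[symmetric]
    unfolding family_energy_def using w pos r
    by (intro D_energy_step_low[OF K]) (simp_all add: divide_right_mono)
qed

text \<open>\<open>rad\<close> and \<open>slide\<close> are the conditions of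
  \<open>D_energy_step_high\<close> for the triangle at \<open>w\<close> with
  \<open>r^2 = w / w'\<close>; its condition \<open>high\<close> follows from
  \<open>a \<le> b \<le> c w\<close>.\<close>

lemma family_energy_less_high:
  assumes w: "b / c \<le> w" "w < w'"
    and rad: "0 < a\<^sup>2 / w' + c\<^sup>2 * w\<^sup>2 / w' - c\<^sup>2 * w"
    and slide: "0 < a * b / w + (a + b) / sqrt w * sqrt (a\<^sup>2 / w' + c\<^sup>2 * w\<^sup>2 / w' - c\<^sup>2 * w) - c\<^sup>2 * w"
  shows "family_energy w < family_energy w'"
proof -
  have "0 < b / c" using pos by simp
  then have w0: "0 < w" "0 < w'" using w by linarith+
  define r where "r = sqrt w / sqrt w'"
  have r: "0 < r" "r < 1" using w w0 by (simp_all add: r_def)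
  have rr: "((a / sqrt w)\<^sup>2 + (c * sqrt w)\<^sup>2) * r\<^sup>2 - (c * sqrt w)\<^sup>2 = a\<^sup>2 / w' + c\<^sup>2 * w\<^sup>2 / w' - c\<^sup>2 * w"
    using w0 by (simp add: r_def power_divide power_mult_distrib field_simps power2_eq_square)
  have "b \<le> c * w" using w pos by (simp add: field_simps)
  moreover have "c * w \<le> c * w'" using w pos by simp
  ultimately have "a \<le> c * w" "a \<le> c * w'" using pos by linarith+
  then have "a * a \<le> (c * w) * (c * w')" using w0 pos by (intro mult_mono) auto
  then have "a\<^sup>2 / w' \<le> c\<^sup>2 * w" using w0 by (simp add: power2_eq_square field_simps)
  moreover have "a\<^sup>2 / w' = (a / sqrt w)\<^sup>2 * r\<^sup>2" using w0 by (simp add: r_def power_divide)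
  ultimately have high: "(a / sqrt w)\<^sup>2 * r\<^sup>2 \<le> (c * sqrt w)\<^sup>2" using w0 by (simp add: power_mult_distrib)
  have "(a / sqrt w) * (b / sqrt w) + (a / sqrt w + b / sqrt w) * sqrt (a\<^sup>2 / w' + c\<^sup>2 * w\<^sup>2 / w' - c\<^sup>2 * w)
      = a * b / w + (a + b) / sqrt w * sqrt (a\<^sup>2 / w' + c\<^sup>2 * w\<^sup>2 / w' - c\<^sup>2 * w)"
    using w0 by (simp add: add_divide_distrib)
  with slide have "(c * sqrt w)\<^sup>2 < (a / sqrt w) * (b / sqrt w) + (a / sqrt w + b / sqrt w) * sqrt (a\<^sup>2 / w' + c\<^sup>2 * w\<^sup>2 / w' - c\<^sup>2 * w)"
    using w0 by (simp add: power_mult_distrib)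
  then show ?thesis
    unfolding family_energy_rescale[OF w0] r_def[symmetric]
    unfolding family_energy_def using w0 pos r high rad
    by (intro D_energy_step_high[OF K]) (simp_all only: rr, simp_all add: divide_right_mono)
qed

text \<open>
  For \<open>w \<ge> b / c\<close> the two slides only exist for small steps, so the comparison is local and is
  propagated along the interval by bisection.
\<close>

lemma family_energy_less_high':
  assumes w: "b / c \<le> w" "w < w'" and w': "c\<^sup>2 * w'\<^sup>2 < a\<^sup>2 + 2 * a * b"
  shows "family_energy w < family_energy w'"
proof -
  have bc: "0 < b / c" using pos by simp
  \<comment> \<open>Taken as functions of the pair \<open>(w, w')\<close>, both conditions hold for
    all short steps around \<open>x\<close> by continuity, once they hold at
    \<open>(x, x)\<close>.\<close>
  define rad where "rad p = a\<^sup>2 / snd p + c\<^sup>2 * (fst p)\<^sup>2 / snd p - c\<^sup>2 * fst p" for p :: "real \<times> real"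
  define slide where "slide p = a * b / fst p + (a + b) / sqrt (fst p) * sqrt (rad p) - c\<^sup>2 * fst p" for p
  have "w \<le> w \<longrightarrow> w' \<le> w' \<longrightarrow> w < w' \<longrightarrow> family_energy w < family_energy w'"
  proof (rule Bolzano[where P = "\<lambda>x y. w \<le> x \<longrightarrow> y \<le> w' \<longrightarrow> x < y \<longrightarrow> family_energy x < family_energy y"])
    show "w \<le> w'" using w by simp
  next
    fix x y z :: real
    assume "w \<le> x \<longrightarrow> y \<le> w' \<longrightarrow> x < y \<longrightarrow> family_energy x < family_energy y"
      "w \<le> y \<longrightarrow> z \<le> w' \<longrightarrow> y < z \<longrightarrow> family_energy y < family_energy z" "x \<le> y" "y \<le> z"
    then show "w \<le> x \<longrightarrow> z \<le> w' \<longrightarrow> x < z \<longrightarrow> family_energy x < family_energy z"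
      by (cases "x = y"; cases "y = z") auto
  next
    fix x :: real
    assume x: "w \<le> x" "x \<le> w'"
    have x0: "0 < x" using bc w x by linarith
    have rad_x: "rad (x, x) = a\<^sup>2 / x"
      using x0 by (simp add: rad_def power2_eq_square)
    \<comment> \<open>The numerator is \<open>|BA|^2 - |BC_t|^2\<close> for \<open>x = 1 + t\<close>
      before rescaling, so positivity on the diagonal is the condition
      \<open>t < t_1\<close>.\<close>
    have slide_x: "slide (x, x) = (a\<^sup>2 + 2 * a * b - c\<^sup>2 * x\<^sup>2) / x"
      using x0 pos unfolding slide_def rad_x by (simp add: real_sqrt_divide power2_eq_square field_simps)
    have "c\<^sup>2 * x\<^sup>2 \<le> c\<^sup>2 * w'\<^sup>2" using x x0 by (intro mult_left_mono power_mono) auto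
    then have "0 < a\<^sup>2 + 2 * a * b - c\<^sup>2 * x\<^sup>2" using w' by linarith
    then have pos_x: "0 < rad (x, x)" "0 < slide (x, x)"
      unfolding rad_x slide_x using x0 pos by simp_all
    have "isCont rad (x, x)"
      unfolding rad_def using x0 by (intro continuous_intros) simp_all
    moreover from this have "isCont slide (x, x)"
      unfolding slide_def using x0 by (intro continuous_intros) simp_all
    ultimately have "(rad \<longlongrightarrow> rad (x, x)) (nhds (x, x))" "(slide \<longlongrightarrow> slide (x, x)) (nhds (x, x))"
      by (simp_all only: isCont_def tendsto_at_iff_tendsto_nhds)
    from order_tendstoD(1)[OF this(2) pos_x(2)] order_tendstoD(1)[OF this(1) pos_x(1)]
    have "\<forall>\<^sub>F p in nhds (x, x). 0 < slide p \<and> 0 < rad p"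
      by (rule eventually_conj)
    then obtain d where d: "0 < d" "\<And>p. dist p (x, x) < d \<Longrightarrow> 0 < slide p \<and> 0 < rad p"
      unfolding eventually_nhds_metric by blast
    have "\<forall>s s'. s \<le> x \<and> x \<le> s' \<and> s' - s < d \<longrightarrow> (w \<le> s \<longrightarrow> s' \<le> w' \<longrightarrow> s < s' \<longrightarrow> family_energy s < family_energy s')"
    proof (intro allI impI; elim conjE)
      fix s s' :: real
      assume s: "s \<le> x" "x \<le> s'" "s' - s < d" "w \<le> s" "s' \<le> w'" "s < s'"
      have "dist (s, s') (x, x) \<le> dist s x + dist s' x"
        unfolding dist_Pair_Pair by (rule sqrt_sum_squares_le_sum) auto
      also have "\<dots> < d" using s by (simp add: dist_real_def)
      finally have "0 < slide (s, s')" "0 < rad (s, s')" using d(2) by blast+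
      then show "family_energy s < family_energy s'"
        using s w by (intro family_energy_less_high) (simp_all add: slide_def rad_def)
    qed
    with d(1) show "\<exists>d>0. \<forall>s s'. s \<le> x \<and> x \<le> s' \<and> s' - s < d \<longrightarrow> (w \<le> s \<longrightarrow> s' \<le> w' \<longrightarrow> s < s' \<longrightarrow> family_energy s < family_energy s')"
      by blast
  qed
  then show ?thesis using w by simp
qed

lemma family_energy_less:
  assumes w: "0 < w" "w < w'" and w': "c\<^sup>2 * w'\<^sup>2 < a\<^sup>2 + 2 * a * b"
  shows "family_energy w < family_energy w'"
proof -
  consider "w' \<le> b / c" | "b / c \<le> w" | "w < b / c" "b / c < w'" by linarith
  then show ?thesis
  proof cases
    case 3
    have "0 < b / c" using pos by simp
    have "family_energy w < family_energy (b / c)" using 3 w by (intro family_energy_less_low) auto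
    also have "\<dots> < family_energy w'" using 3 w' by (intro family_energy_less_high') auto
    finally show ?thesis .
  qed (use w w' family_energy_less_low family_energy_less_high' in auto)
qed

end

section \<open>Reduction of the given triangle to the normalised family\<close>

theorem theorem1p2:
  fixes K :: "real \<Rightarrow> real" and A B C :: "real^2"
  assumes K_C1: "K C1_differentiable_on {0<..}"
    and K_decreasing: "strict_antimono_on {0<..} K"
    and K_integrable: "set_integrable lborel {0<..<1} (\<lambda>r. K r * r)"
    and A_x_axis: "A $ 2 = 0"
    and B_x_axis: "B $ 2 = 0"
    and C_positive_y_axis: "C $ 1 = 0" "C $ 2 > 0"
    and sides: "dist A B > dist B C" "dist B C \<ge> dist A C"
  shows "(\<exists>!t\<^sub>1. t\<^sub>1 > 0 \<and> dist B A = dist B (moved_vertex C t\<^sub>1)) \<and>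
    (\<forall>t\<^sub>1. t\<^sub>1 > 0 \<and> dist B A = dist B (moved_vertex C t\<^sub>1) \<longrightarrow>
      strict_mono_on {-1<..<t\<^sub>1} (\<lambda>t. D_energy K (rescaled_triangle A B C t)))"
proof -
  have K: "continuous_on {0<..} K" using K_C1 by (rule C1_differentiable_imp_continuous_on)
  define a b c where "a = \<bar>A $ 1\<bar>" and "b = \<bar>B $ 1\<bar>" and "c = C $ 2"
  have c: "0 < c" using C_positive_y_axis by (simp add: c_def)
  have BC: "(dist B C)\<^sup>2 = b\<^sup>2 + c\<^sup>2" and AC: "(dist A C)\<^sup>2 = a\<^sup>2 + c\<^sup>2" and AB: "(dist A B)\<^sup>2 = (A $ 1 - B $ 1)\<^sup>2"
    using A_x_axis B_x_axis C_positive_y_axis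
    by (simp_all add: dist_vec2_squared a_def b_def c_def power2_abs)
  have "(dist A C)\<^sup>2 \<le> (dist B C)\<^sup>2" by (rule power_mono) (use sides in simp_all)
  then have ab: "a \<le> b"
    unfolding BC AC using power2_le_imp_le[of a b] by (simp add: b_def)
  have "(dist B C)\<^sup>2 < (dist A B)\<^sup>2" by (rule power_strict_mono) (use sides in simp_all)
  then have long: "b\<^sup>2 + c\<^sup>2 < (A $ 1 - B $ 1)\<^sup>2" unfolding BC AB .
  \<comment> \<open>The origin lies strictly between \<open>A\<close> and \<open>B\<close>:
    otherwise \<open>|AB|\<close> would be at most \<open>|OB|\<close>, which is less than
    \<open>|BC|\<close>.\<close>
  have neg: "A $ 1 * B $ 1 < 0"
  proof (rule ccontr)
    assume "\<not> A $ 1 * B $ 1 < 0"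
    then have "A $ 1 * B $ 1 = a * b" by (simp add: a_def b_def abs_mult[symmetric])
    then have "(A $ 1 - B $ 1)\<^sup>2 = a\<^sup>2 + b\<^sup>2 - 2 * (a * b)"
      by (simp add: power2_diff a_def b_def)
    moreover have "a\<^sup>2 \<le> a * b"
      unfolding power2_eq_square using ab by (rule mult_left_mono) (simp add: a_def)
    moreover have "0 \<le> a\<^sup>2" "0 < c\<^sup>2" using c by simp_all
    ultimately show False using long by linarith
  qed
  then have a: "0 < a" and b: "0 < b" by (auto simp: a_def b_def)
  have "A $ 1 * B $ 1 = - (a * b)" using neg by (simp add: a_def b_def abs_mult[symmetric])
  then have AB2: "(A $ 1 - B $ 1)\<^sup>2 = a\<^sup>2 + b\<^sup>2 + 2 * (a * b)"
    by (simp add: power2_diff a_def b_def)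
  have BC_t: "(dist B (moved_vertex C t))\<^sup>2 = b\<^sup>2 + c\<^sup>2 * (1 + t)\<^sup>2" for t
    using B_x_axis C_positive_y_axis
    by (simp add: dist_vec2_squared moved_vertex_def b_def c_def power_mult_distrib)
  have reach: "dist B A = dist B (moved_vertex C t) \<longleftrightarrow> c\<^sup>2 * (1 + t)\<^sup>2 = a\<^sup>2 + 2 * a * b" for t
  proof -
    have "dist B A = dist B (moved_vertex C t) \<longleftrightarrow> (dist A B)\<^sup>2 = (dist B (moved_vertex C t))\<^sup>2"
      by (simp add: dist_commute power2_eq_iff_nonneg)
    also have "\<dots> \<longleftrightarrow> c\<^sup>2 * (1 + t)\<^sup>2 = a\<^sup>2 + 2 * a * b"
      unfolding AB AB2 BC_t by auto
    finally show ?thesis .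
  qed
  \<comment> \<open>\<open>W\<close> is the value of \<open>1 + t\<close> at which
    \<open>BC_t\<close> becomes as long as \<open>BA\<close>; \<open>W > 1\<close> expresses
    \<open>|BC| < |AB|\<close>.\<close>
  define W where "W = sqrt ((a\<^sup>2 + 2 * a * b) / c\<^sup>2)"
  have W2: "c\<^sup>2 * W\<^sup>2 = a\<^sup>2 + 2 * a * b"
    using a b c by (simp add: W_def)
  have "c\<^sup>2 < a\<^sup>2 + 2 * a * b" using long AB2 by simp
  then have W1: "1 < W" using c by (simp add: W_def)
  have reach': "dist B A = dist B (moved_vertex C t) \<longleftrightarrow> t = W - 1" if "0 < t" for t
  proof -
    have "c\<^sup>2 * (1 + t)\<^sup>2 = a\<^sup>2 + 2 * a * b \<longleftrightarrow> (1 + t)\<^sup>2 = W\<^sup>2"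
      unfolding W2[symmetric] using c by simp
    also have "\<dots> \<longleftrightarrow> 1 + t = W"
      using that W1 by (intro power2_eq_iff_nonneg) auto
    finally show ?thesis unfolding reach by auto
  qed
  have energy: "D_energy K (rescaled_triangle A B C t) = family_energy K a b c (1 + t)" if t: "-1 < t" for t
  proof -
    define \<sigma> where "\<sigma> = 1 / sqrt (1 + t)"
    have \<sigma>: "0 < \<sigma>" using t by (simp add: \<sigma>_def)
    have "C \<noteq> 0" using c by (auto simp: c_def)
    then have "sqrt (dist 0 C / dist 0 (moved_vertex C t)) = \<sigma>"
      using t by (simp add: moved_vertex_def \<sigma>_def real_sqrt_divide)
    then have "rescaled_triangle A B C t = triangle (\<sigma> *\<^sub>R A) (\<sigma> *\<^sub>R B) (\<sigma> *\<^sub>R moved_vertex C t)"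
      unfolding rescaled_triangle_def triangle_def
      by (simp add: convex_hull_scaling[symmetric])
    also have "D_energy K \<dots> = D_energy K (std_triangle \<bar>(\<sigma> *\<^sub>R A) $ 1\<bar> \<bar>(\<sigma> *\<^sub>R B) $ 1\<bar> ((\<sigma> *\<^sub>R moved_vertex C t) $ 2))"
    proof (rule D_energy_std_triangle[OF K K_decreasing K_integrable])
      have "(\<sigma> *\<^sub>R A) $ 1 * (\<sigma> *\<^sub>R B) $ 1 = \<sigma>\<^sup>2 * (A $ 1 * B $ 1)" by (simp add: power2_eq_square)
      also have "\<dots> < 0" by (rule mult_pos_neg) (use neg \<sigma> in simp_all)
      finally show "(\<sigma> *\<^sub>R A) $ 1 * (\<sigma> *\<^sub>R B) $ 1 < 0" .
    qed (use A_x_axis B_x_axis C_positive_y_axis \<sigma> t in \<open>simp_all add: moved_vertex_def\<close>)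
    also have "\<bar>(\<sigma> *\<^sub>R A) $ 1\<bar> = a / sqrt (1 + t)"
      using t by (simp add: \<sigma>_def a_def)
    also have "\<bar>(\<sigma> *\<^sub>R B) $ 1\<bar> = b / sqrt (1 + t)"
      using t by (simp add: \<sigma>_def b_def)
    also have "(\<sigma> *\<^sub>R moved_vertex C t) $ 2 = c * sqrt (1 + t)"
      using t by (simp add: \<sigma>_def moved_vertex_def c_def real_div_sqrt)
    finally show ?thesis by (simp add: family_energy_def[OF K K_decreasing K_integrable a ab c])
  qed
  have mono: "strict_mono_on {-1<..<W - 1} (\<lambda>t. D_energy K (rescaled_triangle A B C t))"
  proof (rule strict_mono_onI)
    fix s t assume st: "s \<in> {-1<..<W - 1}" "t \<in> {-1<..<W - 1}" "s < t"
    have "(1 + t)\<^sup>2 < W\<^sup>2" using st by (intro power_strict_mono) auto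
    then have "c\<^sup>2 * (1 + t)\<^sup>2 < a\<^sup>2 + 2 * a * b" unfolding W2[symmetric] using c by simp
    then show "D_energy K (rescaled_triangle A B C s) < D_energy K (rescaled_triangle A B C t)"
      using st energy family_energy_less[OF K K_decreasing K_integrable a ab c, of "1 + s" "1 + t"] by simp
  qed
  show ?thesis
  proof (intro conjI allI impI)
    show "\<exists>!t\<^sub>1. t\<^sub>1 > 0 \<and> dist B A = dist B (moved_vertex C t\<^sub>1)"
      using W1 reach' by (intro ex1I[of _ "W - 1"]) auto
    show "strict_mono_on {-1<..<t\<^sub>1} (\<lambda>t. D_energy K (rescaled_triangle A B C t))"
      if "t\<^sub>1 > 0 \<and> dist B A = dist B (moved_vertex C t\<^sub>1)" for t\<^sub>1
      using that reach' mono by auto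
  qed
qed

end
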